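(* Let $\Gamma$ be a metric graph, $q\in\Gamma$, and $D$ a divisor on $\Gamma$ with $D(p)\ge 0$ for all $p\ne q$. Then $D$ is $q$-reduced if and only if $\mathcal{E}_q(D)<\mathcal{E}_q(D')$ for every $D'\in|D|_q$ with $D'\ne D$.
   Context: $\Gamma$ is a compact connected metric graph (edges identified with real segments of given positive lengths). $R(\Gamma)$ is the group of continuous piecewise affine functions $\Gamma\to\mathbb{R}$ with integer slopes. $\operatorname{Div}(\Gamma)$ is the free abelian group on the points of $\Gamma$; for $D=\sum a_p(p)$ write $D(p)=a_p$ and $\deg D=\sum a_p$. For a continuous piecewise affine $f$, $\Delta(f)=\sum_{p\in\Gamma}\sigma_p(f)(p)$, where $-\sigma_p(f)$ is the sum of the outgoing slopes of $f$ over all tangent directions at $p$; every real divisor of degree $0$ is $\Delta(f)$ for some continuous piecewise affine $f$, unique up to constants. $D\sim D'$ if $D-D'=\Delta(f)$ for some $f\in R(\Gamma)$. $|D|_q=\{E\in\operatorname{Div}(\Gamma):E\sim D,\ E(p)\ge 0\ \forall p\ne q\}$. A divisor $D$ is $q$-reduced if (R1) $D(p)\ge 0$ for all $p\ne q$, and (R2) for every non-constant $f\in R(\Gamma)$ attaining its global maximum at $q$, $D+\Delta(f)\notin|D|_q$. The energy pairing of degree-zero divisors $\mu=\Delta(f)$, $\nu$ is $\langle\mu,\nu\rangle=\sum_{p}\nu(p)f(p)$ (equivalently $\int f'(x)g'(x)\,dx$ if $\nu=\Delta(g)$); it is well defined, symmetric and positive definite. For $D$ of degree $d$, $\mathcal{E}_q(D)=\langle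 D-d(q),D-d(q)\rangle$. *)

theory Defs
  imports "HOL-Analysis.Analysis"
begin

text \<open>A metric graph is given by a finite combinatorial model: a finite vertex set,
  a finite edge set (loops and multiple edges allowed), endpoint maps and positive
  edge lengths. The underlying combinatorial graph must be connected.\<close>

record ('v, 'e) mgraph =
  verts :: "'v set"
  edges :: "'e set"
  src   :: "'e \<Rightarrow> 'v"
  tgt   :: "'e \<Rightarrow> 'v"
  len   :: "'e \<Rightarrow> real"

definition metric_graph :: "('v, 'e) mgraph \<Rightarrow> bool" where
  "metric_graph G \<longleftrightarrow>
     finite (verts G) \<and> finite (edges G) \<and>
     (\<forall>e\<in>edges G. src G e \<in> verts G \<and> tgt G e \<in> verts G \<and> len G e > 0) \<and>
     (\<forall>u\<in>verts G. \<forall>v\<in>verts G.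
        (u, v) \<in> ({(src G e, tgt G e) | e. e \<in> edges G} \<union>
                  {(tgt G e, src G e) | e. e \<in> edges G})\<^sup>*)"

text \<open>Points of the metric graph: vertices, or interior points of edges
  (edge e, parameter t with 0 < t < len e).\<close>

datatype ('v, 'e) pt = Vert 'v | Inner 'e real

fun valid :: "('v, 'e) mgraph \<Rightarrow> ('v, 'e) pt \<Rightarrow> bool" where
  "valid G (Vert v) \<longleftrightarrow> v \<in> verts G"
| "valid G (Inner e t) \<longleftrightarrow> e \<in> edges G \<and> 0 < t \<and> t < len G e"

text \<open>Arc-length parametrisation of edge e by [0, len e].\<close>
definition param :: "('v, 'e) mgraph \<Rightarrow> 'e \<Rightarrow> real \<Rightarrow> ('v, 'e) pt" where
  "param G e t = (if t = 0 then Vert (src G e) else if t = len G e then Vert (tgt G e)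
                  else Inner e t)"

definition edgefun :: "('v, 'e) mgraph \<Rightarrow> (('v, 'e) pt \<Rightarrow> real) \<Rightarrow> 'e \<Rightarrow> real \<Rightarrow> real" where
  "edgefun G f e t = f (param G e t)"

text \<open>Continuous piecewise affine on [a,b] with slopes in S.\<close>
definition pw_affine :: "real set \<Rightarrow> (real \<Rightarrow> real) \<Rightarrow> real \<Rightarrow> real \<Rightarrow> bool" where
  "pw_affine S g a b \<longleftrightarrow>
     (\<exists>xs::real list. length xs \<ge> 2 \<and> hd xs = a \<and> last xs = b \<and> sorted_wrt (<) xs \<and>
        (\<forall>i < length xs - 1. \<exists>c\<in>S. \<forall>t\<in>{xs ! i .. xs ! Suc i}.
            g t = g (xs ! i) + c * (t - xs ! i)))"

text \<open>Continuous piecewise affine functions on the metric graph (real slopes),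
  and the group R(Gamma) (integer slopes).\<close>
definition PA :: "('v, 'e) mgraph \<Rightarrow> (('v, 'e) pt \<Rightarrow> real) set" where
  "PA G = {f. \<forall>e\<in>edges G. pw_affine UNIV (edgefun G f e) 0 (len G e)}"

definition RG :: "('v, 'e) mgraph \<Rightarrow> (('v, 'e) pt \<Rightarrow> real) set" where
  "RG G = {f. \<forall>e\<in>edges G. pw_affine \<int> (edgefun G f e) 0 (len G e)}"

text \<open>One-sided derivatives (slopes) of a real function.\<close>
definition rslope :: "(real \<Rightarrow> real) \<Rightarrow> real \<Rightarrow> real" where
  "rslope g t = (THE c. (g has_real_derivative c) (at t within {t..}))"

definition lslope :: "(real \<Rightarrow> real) \<Rightarrow> real \<Rightarrow> real" where
  "lslope g t = (THE c. (g has_real_derivative c) (at t within {..t}))"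

text \<open>Laplacian: Delta f (p) = sigma_p(f) = - (sum of outgoing slopes of f at p).
  At a vertex v, an edge e with src e = v has outgoing slope rslope at 0, an edge with
  tgt e = v has outgoing slope -lslope at len e (a loop contributes both).\<close>
fun Delta :: "('v, 'e) mgraph \<Rightarrow> (('v, 'e) pt \<Rightarrow> real) \<Rightarrow> ('v, 'e) pt \<Rightarrow> real" where
  "Delta G f (Vert v) =
     (if v \<in> verts G then
        - ((\<Sum>e\<in>{e\<in>edges G. src G e = v}. rslope (edgefun G f e) 0)
           - (\<Sum>e\<in>{e\<in>edges G. tgt G e = v}. lslope (edgefun G f e) (len G e)))
      else 0)"
| "Delta G f (Inner e t) =
     (if valid G (Inner e t) then
        - (rslope (edgefun G f e) t - lslope (edgefun G f e) t)
      else 0)"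

text \<open>Divisors: finitely supported integer functions on the points of Gamma.\<close>
definition is_div :: "('v, 'e) mgraph \<Rightarrow> (('v, 'e) pt \<Rightarrow> int) \<Rightarrow> bool" where
  "is_div G D \<longleftrightarrow> finite {p. D p \<noteq> 0} \<and> (\<forall>p. \<not> valid G p \<longrightarrow> D p = 0)"

definition deg :: "(('v, 'e) pt \<Rightarrow> int) \<Rightarrow> int" where
  "deg D = (\<Sum>p\<in>{p. D p \<noteq> 0}. D p)"

definition lin_equiv :: "('v, 'e) mgraph \<Rightarrow> (('v, 'e) pt \<Rightarrow> int) \<Rightarrow> (('v, 'e) pt \<Rightarrow> int) \<Rightarrow> bool" where
  "lin_equiv G D D' \<longleftrightarrow>
     (\<exists>f\<in>RG G. \<forall>p. valid G p \<longrightarrow> real_of_int (D p - D' p) = Delta G f p)"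

text \<open>|D|_q\<close>
definition lin_sys :: "('v, 'e) mgraph \<Rightarrow> ('v, 'e) pt \<Rightarrow> (('v, 'e) pt \<Rightarrow> int) \<Rightarrow> (('v, 'e) pt \<Rightarrow> int) set" where
  "lin_sys G q D = {E. is_div G E \<and> lin_equiv G E D \<and> (\<forall>p. valid G p \<longrightarrow> p \<noteq> q \<longrightarrow> E p \<ge> 0)}"

text \<open>D + Delta(f) as an (integer) divisor, for f in R(Gamma) (Delta f is integral).\<close>
definition div_plus_Delta :: "('v, 'e) mgraph \<Rightarrow> (('v, 'e) pt \<Rightarrow> int) \<Rightarrow> (('v, 'e) pt \<Rightarrow> real) \<Rightarrow> ('v, 'e) pt \<Rightarrow> int" where
  "div_plus_Delta G D f = (\<lambda>p. D p + \<lfloor>Delta G f p\<rfloor>)"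

definition q_reduced :: "('v, 'e) mgraph \<Rightarrow> ('v, 'e) pt \<Rightarrow> (('v, 'e) pt \<Rightarrow> int) \<Rightarrow> bool" where
  "q_reduced G q D \<longleftrightarrow>
     (\<forall>p. valid G p \<longrightarrow> p \<noteq> q \<longrightarrow> D p \<ge> 0) \<and>
     (\<forall>f\<in>RG G. (\<exists>p p'. valid G p \<and> valid G p' \<and> f p \<noteq> f p') \<longrightarrow>
                 (\<forall>p. valid G p \<longrightarrow> f p \<le> f q) \<longrightarrow>
                 div_plus_Delta G D f \<notin> lin_sys G q D)"

text \<open>Energy pairing of real degree-zero divisors: <mu, nu> = sum_p nu(p) f(p)
  where mu = Delta f with f continuous piecewise affine.\<close>
definition energy :: "('v, 'e) mgraph \<Rightarrow> (('v, 'e) pt \<Rightarrow> real) \<Rightarrow> (('v, 'e) pt \<Rightarrow> real) \<Rightarrow> real" where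
  "energy G mu nu =
     (let f = (SOME f. f \<in> PA G \<and> (\<forall>p. valid G p \<longrightarrow> Delta G f p = mu p))
      in \<Sum>p\<in>{p. nu p \<noteq> 0}. nu p * f p)"

text \<open>E_q(D) = <D - d(q), D - d(q)>, d = deg D.\<close>
definition Eq :: "('v, 'e) mgraph \<Rightarrow> ('v, 'e) pt \<Rightarrow> (('v, 'e) pt \<Rightarrow> int) \<Rightarrow> real" where
  "Eq G q D =
     (let mu = (\<lambda>p. real_of_int (D p) - (if p = q then real_of_int (deg D) else 0))
      in energy G mu mu)"

end

theory Submission
  imports Defs
begin

text \<open>If \<open>D' = D + \<Delta>(f)\<close>, bilinearity and symmetry of the energy pairing give
  \<open>E\<^sub>q(D') - E\<^sub>q(D) = \<Sum>\<^sub>p (D(p) + D'(p)) (f(p) - f(q))\<close>, where the term at \<open>q\<close> vanishes and the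
  coefficients at \<open>p \<noteq> q\<close> are nonnegative. Hence a non-constant \<open>f\<close> with maximum at \<open>q\<close> that violates
  (R2) does not increase the energy. Conversely, let \<open>D\<close> be reduced. If \<open>f\<close> took a value below \<open>f(q)\<close>,
  the function \<open>min f (f q)\<close> would violate (R2); so \<open>f \<ge> f(q)\<close>, and the difference is at least
  \<open>\<langle>\<Delta>(f), \<Delta>(f)\<rangle> > 0\<close>.\<close>

section \<open>One-sided slopes\<close>

text \<open>Two obstacles shape the work. \<open>energy\<close> selects a potential with
  \<open>SOME\<close>, so nothing can be computed until \<open>Delta G h = \<mu>\<close> is solved
  for every finitely supported \<open>\<mu>\<close> of total mass zero on the graph. Mass inside
  edges is produced by explicit tents; the rest sits on vertices, where solvability is
  finite-dimensional: an obstruction is the vertex data of a harmonic function, constant by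
  connectedness, hence orthogonal to mass zero. Second, \<open>pw_affine\<close> gives each function
  its own list of breakpoints, while symmetry of the pairing compares two functions. In place of
  common refinements, functions are described by affine germs on either side of each point, and
  compactness of the interval recovers pieces on which both are affine.\<close>

definition affine_right :: "(real \<Rightarrow> real) \<Rightarrow> real \<Rightarrow> real \<Rightarrow> bool" where
  "affine_right g x c \<longleftrightarrow> (\<forall>\<^sub>F t in at_right x. g t = g x + c * (t - x))"

definition affine_left :: "(real \<Rightarrow> real) \<Rightarrow> real \<Rightarrow> real \<Rightarrow> bool" where
  "affine_left g x c \<longleftrightarrow> (\<forall>\<^sub>F t in at_left x. g t = g x + c * (t - x))"

lemma at_within_atLeast_eq: "at (x::real) within {x..} = at_right x"
  by (rule at_within_nhd [where S = UNIV]) auto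

lemma at_within_atMost_eq: "at (x::real) within {..x} = at_left x"
  by (rule at_within_nhd [where S = UNIV]) auto

lemma affine_has_derivative:
  assumes "\<forall>\<^sub>F t in at x within A. g t = g x + c * (t - x)"
  shows "(g has_real_derivative c) (at x within A)"
proof -
  have "\<forall>\<^sub>F t in at x within A. c = (g t - g x) / (t - x)"
    using assms unfolding eventually_at_filter by eventually_elim (auto simp: field_simps)
  then show ?thesis
    unfolding has_field_derivative_iff by (rule tendsto_eventually [OF eventually_mono]) simp
qed

text \<open>The filter \<open>at_right x\<close> is nontrivial, so one-sided derivatives are unique
  and an affine germ determines the definite description.\<close>

lemma rslope_eq:
  assumes "affine_right g x c"
  shows "rslope g x = c"
proof -
  have c: "(g has_real_derivative c) (at x within {x..})"
    using assms by (intro affine_has_derivative) (simp add: affine_right_def at_within_atLeast_eq)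
  show ?thesis
    unfolding rslope_def
  proof (rule the_equality)
    show "(g has_real_derivative c) (at x within {x..})" by (fact c)
    fix d assume "(g has_real_derivative d) (at x within {x..})"
    with c show "d = c"
      unfolding has_field_derivative_iff at_within_atLeast_eq
      using tendsto_unique[OF trivial_limit_at_right_real] by blast
  qed
qed

lemma lslope_eq:
  assumes "affine_left g x c"
  shows "lslope g x = c"
proof -
  have c: "(g has_real_derivative c) (at x within {..x})"
    using assms by (intro affine_has_derivative) (simp add: affine_left_def at_within_atMost_eq)
  show ?thesis
    unfolding lslope_def
  proof (rule the_equality)
    show "(g has_real_derivative c) (at x within {..x})" by (fact c)
    fix d assume "(g has_real_derivative d) (at x within {..x})"
    with c show "d = c"
      unfolding has_field_derivative_iff at_within_atMost_eq
      using tendsto_unique[OF trivial_limit_at_left_real] by blast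
  qed
qed

lemma affine_right_lincomb:
  assumes "affine_right f x c" "affine_right g x d"
  shows "affine_right (\<lambda>t. a * f t + b * g t) x (a * c + b * d)"
  using assms unfolding affine_right_def
  by eventually_elim algebra

lemma affine_left_lincomb:
  assumes "affine_left f x c" "affine_left g x d"
  shows "affine_left (\<lambda>t. a * f t + b * g t) x (a * c + b * d)"
  using assms unfolding affine_left_def
  by eventually_elim algebra

lemma affine_right_eventually_less:
  assumes "affine_right f x s" "f x < k"
  shows "\<forall>\<^sub>F t in at_right x. f t < k"
proof -
  have "((\<lambda>t. f x + s * (t - x)) \<longlongrightarrow> f x + s * (x - x)) (at_right x)"
    by (intro tendsto_intros)
  then have "\<forall>\<^sub>F t in at_right x. f x + s * (t - x) < k"
    using assms(2) by (auto dest: order_tendstoD(2))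
  with assms(1) show ?thesis
    unfolding affine_right_def by eventually_elim simp
qed

lemma affine_left_eventually_less:
  assumes "affine_left f x s" "f x < k"
  shows "\<forall>\<^sub>F t in at_left x. f t < k"
proof -
  have "((\<lambda>t. f x + s * (t - x)) \<longlongrightarrow> f x + s * (x - x)) (at_left x)"
    by (intro tendsto_intros)
  then have "\<forall>\<^sub>F t in at_left x. f x + s * (t - x) < k"
    using assms(2) by (auto dest: order_tendstoD(2))
  with assms(1) show ?thesis
    unfolding affine_left_def by eventually_elim simp
qed

text \<open>The delicate case is \<open>f x = k\<close>: there \<open>t - x > 0\<close>, so the sign
  of \<open>s\<close> decides which branch of the minimum wins.\<close>

lemma affine_right_min:
  assumes "affine_right f x s"
  shows "affine_right (\<lambda>t. min (f t) k) x
           (if f x < k then s else if k < f x then 0 else min s 0)"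
proof -
  consider "f x < k" | "k < f x" | "f x = k" by linarith
  then show ?thesis
  proof cases
    case 1
    with affine_right_eventually_less[OF assms] have "\<forall>\<^sub>F t in at_right x. f t < k" by blast
    with assms show ?thesis
      unfolding affine_right_def by eventually_elim (use 1 in simp)
  next
    case 2
    have "affine_right (\<lambda>t. - f t) x (- s)"
      using assms unfolding affine_right_def by eventually_elim simp
    from affine_right_eventually_less[OF this, of "- k"] 2 have "\<forall>\<^sub>F t in at_right x. k < f t" by simp
    then show ?thesis
      unfolding affine_right_def by eventually_elim (use 2 in simp)
  next
    case 3
    have "\<forall>\<^sub>F t in at_right x. x < t" by (simp add: eventually_at_right_less)
    with assms show ?thesis
      unfolding affine_right_def
      by eventually_elim (use 3 in \<open>auto simp: min_def mult_le_0_iff\<close>)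
  qed
qed

text \<open>To the left \<open>t - x\<close> is negative, so at the level \<open>k\<close> the
  smaller value belongs to the larger slope: \<open>max\<close> replaces \<open>min\<close>.\<close>

lemma affine_left_min:
  assumes "affine_left f x s"
  shows "affine_left (\<lambda>t. min (f t) k) x
           (if f x < k then s else if k < f x then 0 else max s 0)"
proof -
  consider "f x < k" | "k < f x" | "f x = k" by linarith
  then show ?thesis
  proof cases
    case 1
    with affine_left_eventually_less[OF assms] have "\<forall>\<^sub>F t in at_left x. f t < k" by blast
    with assms show ?thesis
      unfolding affine_left_def by eventually_elim (use 1 in simp)
  next
    case 2
    have "affine_left (\<lambda>t. - f t) x (- s)"
      using assms unfolding affine_left_def by eventually_elim simp
    from affine_left_eventually_less[OF this, of "- k"] 2 have "\<forall>\<^sub>F t in at_left x. k < f t" by simp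
    then show ?thesis
      unfolding affine_left_def by eventually_elim (use 2 in simp)
  next
    case 3
    have "\<forall>\<^sub>F t in at_left x. t < x" by (auto simp: eventually_at_filter)
    with assms show ?thesis
      unfolding affine_left_def
      by eventually_elim (use 3 in \<open>auto simp: min_def max_def mult_le_0_iff\<close>)
  qed
qed

section \<open>Piecewise affine functions on an interval\<close>

text \<open>One slope per point and side, so pointwise operations need no bookkeeping of
  breakpoints. Only the sides facing into the interval are constrained, since \<open>edgefun\<close>
  carries no information beyond its edge.\<close>

definition locally_affine :: "real set \<Rightarrow> (real \<Rightarrow> real) \<Rightarrow> real \<Rightarrow> real \<Rightarrow> bool" where
  "locally_affine S g a b \<longleftrightarrow>
     (\<forall>x. a \<le> x \<and> x < b \<longrightarrow> (\<exists>c\<in>S. affine_right g x c)) \<and>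
     (\<forall>x. a < x \<and> x \<le> b \<longrightarrow> (\<exists>c\<in>S. affine_left g x c))"

definition affine_on :: "(real \<Rightarrow> real) \<Rightarrow> real \<Rightarrow> real \<Rightarrow> real \<Rightarrow> bool" where
  "affine_on g c u v \<longleftrightarrow> (\<forall>t\<in>{u..v}. g t = g u + c * (t - u))"

lemma affine_onD: "affine_on g c u v \<Longrightarrow> u \<le> t \<Longrightarrow> t \<le> v \<Longrightarrow> g t = g u + c * (t - u)"
  unfolding affine_on_def by (drule bspec[of _ _ t]) auto

lemma affine_on_imp_right:
  assumes "affine_on g c u v" "u \<le> x" "x < v"
  shows "affine_right g x c"
proof -
  have "g t = g x + c * (t - x)" if "x < t" "t < v" for t
  proof -
    have "g t = g u + c * (t - u)" "g x = g u + c * (x - u)"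
      using assms that by (auto intro!: affine_onD)
    then show ?thesis by algebra
  qed
  then show ?thesis
    unfolding affine_right_def eventually_at_right_field using \<open>x < v\<close> by blast
qed

lemma affine_on_imp_left:
  assumes "affine_on g c u v" "u < x" "x \<le> v"
  shows "affine_left g x c"
proof -
  have "g t = g x + c * (t - x)" if "u < t" "t < x" for t
  proof -
    have "g t = g u + c * (t - u)" "g x = g u + c * (x - u)"
      using assms that by (auto intro!: affine_onD)
    then show ?thesis by algebra
  qed
  then show ?thesis
    unfolding affine_left_def eventually_at_left_field using \<open>u < x\<close> by blast
qed

lemma affine_right_imp_on:
  assumes "affine_right g x c"
  obtains d where "d > 0" "\<And>v. v < x + d \<Longrightarrow> affine_on g c x v"
proof -
  obtain b where b: "b > x" "\<And>t. x < t \<Longrightarrow> t < b \<Longrightarrow> g t = g x + c * (t - x)"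
    using assms unfolding affine_right_def eventually_at_right_field by blast
  show thesis
  proof (rule that[of "b - x"])
    fix v assume v: "v < x + (b - x)"
    have *: "g t = g x + c * (t - x)" if "x \<le> t" "t < b" for t
      using b(2)[of t] that by (cases "t = x") auto
    show "affine_on g c x v"
      unfolding affine_on_def
    proof
      fix t assume "t \<in> {x..v}"
      then show "g t = g x + c * (t - x)"
        by (intro *) (use v in auto)
    qed
  qed (use b in simp)
qed

lemma affine_left_imp_on:
  assumes "affine_left g x c"
  obtains d where "d > 0" "\<And>u. x - d < u \<Longrightarrow> u \<le> x \<Longrightarrow> affine_on g c u x"
proof -
  obtain b where b: "b < x" "\<And>t. b < t \<Longrightarrow> t < x \<Longrightarrow> g t = g x + c * (t - x)"
    using assms unfolding affine_left_def eventually_at_left_field by blast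
  show thesis
  proof (rule that[of "x - b"])
    fix u assume u: "x - (x - b) < u" "u \<le> x"
    have *: "g t = g x + c * (t - x)" if "b < t" "t \<le> x" for t
      using b(2)[of t] that by (cases "t = x") auto
    show "affine_on g c u x"
      unfolding affine_on_def
    proof
      fix t assume "t \<in> {u..x}"
      then have "g t = g x + c * (t - x)" "g u = g x + c * (u - x)"
        using u by (auto intro!: *)
      then show "g t = g u + c * (t - u)" by algebra
    qed
  qed (use b in simp)
qed

text \<open>Compactness in the form of Bolzano's bisection: germs give small pieces on which both
  functions are affine, and \<open>glue\<close> assembles them. Handling two functions at once
  stands in for a common refinement; a statement about one function uses the rule with that function
  twice.\<close>

lemma locally_affine_induct [consumes 3, case_names affine glue]:
  assumes "a < b" "locally_affine S f a b" "locally_affine T g a b"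
    and base: "\<And>u v c d. \<lbrakk>a \<le> u; u < v; v \<le> b; c \<in> S; d \<in> T; affine_on f c u v; affine_on g d u v\<rbrakk> \<Longrightarrow> P u v"
    and glue: "\<And>u v w. \<lbrakk>a \<le> u; u < v; v < w; w \<le> b; P u v; P v w\<rbrakk> \<Longrightarrow> P u w"
  shows "P a b"
proof -
  \<comment> \<open>\<open>Bolzano\<close> also produces degenerate intervals and intervals reaching
    outside \<open>[a, b]\<close>; \<open>Q\<close> is vacuous on both.\<close>
  define Q where "Q u v \<longleftrightarrow> (a \<le> u \<and> u < v \<and> v \<le> b \<longrightarrow> P u v)" for u v
  have "Q a b"
    using less_imp_le[OF \<open>a < b\<close>]
  proof (induction rule: Bolzano)
    case (trans u v w)
    then show ?case
      using glue[of u v w] unfolding Q_def by (cases "u = v"; cases "v = w") auto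
  next
    case (local x)
    \<comment> \<open>At \<open>x = b\<close> nothing lies to the right, so any positive radius
      serves; \<open>d2\<close> below treats \<open>x = a\<close> likewise.\<close>
    obtain d1 where d1: "d1 > 0" "\<And>v. x < v \<Longrightarrow> v \<le> b \<Longrightarrow> v < x + d1 \<Longrightarrow> P x v"
    proof (cases "x < b")
      case True
      then obtain c d where "c \<in> S" "affine_right f x c" "d \<in> T" "affine_right g x d"
        using assms(2,3) local unfolding locally_affine_def by meson
      moreover obtain h1 where "h1 > 0" "\<And>v. v < x + h1 \<Longrightarrow> affine_on f c x v"
        using affine_right_imp_on[OF \<open>affine_right f x c\<close>] by blast
      moreover obtain h2 where "h2 > 0" "\<And>v. v < x + h2 \<Longrightarrow> affine_on g d x v"
        using affine_right_imp_on[OF \<open>affine_right g x d\<close>] by blast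
      ultimately show thesis
        using base local(1) by (intro that[of "min h1 h2"]) auto
    qed (use that[of 1] in auto)
    obtain d2 where d2: "d2 > 0" "\<And>u. a \<le> u \<Longrightarrow> u < x \<Longrightarrow> x - d2 < u \<Longrightarrow> P u x"
    proof (cases "a < x")
      case True
      then obtain c d where "c \<in> S" "affine_left f x c" "d \<in> T" "affine_left g x d"
        using assms(2,3) local unfolding locally_affine_def by meson
      moreover obtain h1 where "h1 > 0" "\<And>u. x - h1 < u \<Longrightarrow> u \<le> x \<Longrightarrow> affine_on f c u x"
        using affine_left_imp_on[OF \<open>affine_left f x c\<close>] by blast
      moreover obtain h2 where "h2 > 0" "\<And>u. x - h2 < u \<Longrightarrow> u \<le> x \<Longrightarrow> affine_on g d u x"
        using affine_left_imp_on[OF \<open>affine_left g x d\<close>] by blast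
      ultimately show thesis
        using base local(2) by (intro that[of "min h1 h2"]) auto
    qed (use that[of 1] in auto)
    have "Q u v" if "u \<le> x \<and> x \<le> v \<and> v - u < min d1 d2" for u v
    proof -
      have "P u v" if "a \<le> u" "u < v" "v \<le> b"
        using \<open>u \<le> x \<and> x \<le> v \<and> v - u < min d1 d2\<close> that d1(2)[of v] d2(2)[of u] glue[of u x v]
        by (cases "u = x"; cases "v = x") auto
      then show ?thesis by (simp add: Q_def)
    qed
    then show ?case
      using d1(1) d2(1) by (intro exI[of _ "min d1 d2"]) auto
  qed
  then show ?thesis
    using \<open>a < b\<close> by (simp add: Q_def)
qed

section \<open>Breakpoint lists versus germs\<close>

lemma pw_affine_altdef:
  "pw_affine S g a b \<longleftrightarrow>
     (\<exists>xs. length xs \<ge> 2 \<and> hd xs = a \<and> last xs = b \<and> sorted_wrt (<) xs \<and>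
        (\<forall>i < length xs - 1. \<exists>c\<in>S. affine_on g c (xs ! i) (xs ! Suc i)))"
  unfolding pw_affine_def affine_on_def ..

lemma pw_affine_imp_less:
  assumes "pw_affine S g a b"
  shows "a < b"
proof -
  obtain xs where xs: "length xs \<ge> 2" "hd xs = a" "last xs = b" "sorted_wrt (<) xs"
    using assms unfolding pw_affine_altdef by blast
  then obtain x ys where "xs = x # ys" "ys \<noteq> []"
    by (cases xs) (auto simp: Suc_le_length_iff)
  with xs show ?thesis by auto
qed

lemma pw_affine_imp_locally_affine:
  assumes "pw_affine S g a b"
  shows "locally_affine S g a b"
proof -
  obtain xs where "length xs \<ge> 2" "sorted_wrt (<) xs" "hd xs = a" "last xs = b"
      "\<forall>i < length xs - 1. \<exists>c\<in>S. affine_on g c (xs ! i) (xs ! Suc i)"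
    using assms unfolding pw_affine_altdef by blast
  then show ?thesis
  proof (induction xs arbitrary: a)
    case (Cons x ys)
    then obtain y zs where ys: "ys = y # zs" by (cases ys) auto
    have "x = a" using Cons by simp
    obtain c where c: "c \<in> S" "affine_on g c x y"
      using Cons.prems(5) ys by fastforce
    have xy: "x < y" using Cons ys by auto
    have R: "\<exists>c\<in>S. affine_right g t c" if "a \<le> t" "t < y" for t
      using affine_on_imp_right[OF c(2), of t] c(1) that \<open>x = a\<close> by blast
    have L: "\<exists>c\<in>S. affine_left g t c" if "a < t" "t \<le> y" for t
      using affine_on_imp_left[OF c(2), of t] c(1) that \<open>x = a\<close> by blast
    show ?case
    proof (cases zs)
      case Nil
      with Cons ys have "b = y" by simp
      with R L show ?thesis by (auto simp: locally_affine_def)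
    next
      case (Cons z zs')
      have "locally_affine S g y b"
      proof (rule Cons.IH)
        show "\<forall>i<length ys - 1. \<exists>c\<in>S. affine_on g c (ys ! i) (ys ! Suc i)"
        proof (intro allI impI)
          fix i assume "i < length ys - 1"
          then show "\<exists>c\<in>S. affine_on g c (ys ! i) (ys ! Suc i)"
            using Cons.prems(5)[rule_format, of "Suc i"] ys by simp
        qed
      qed (use Cons.prems ys Cons in auto)
      with R L show ?thesis
        unfolding locally_affine_def by (meson linorder_not_less)
    qed
  qed simp
qed

lemma pw_affine_glue:
  assumes "pw_affine S g a c" "pw_affine S g c b"
  shows "pw_affine S g a b"
proof -
  obtain xs where xs: "length xs \<ge> 2" "hd xs = a" "last xs = c" "sorted_wrt (<) xs"
      "\<forall>i < length xs - 1. \<exists>c\<in>S. affine_on g c (xs ! i) (xs ! Suc i)"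
    using assms(1) unfolding pw_affine_altdef by (elim exE conjE) (rule that)
  obtain ys' where ys': "length ys' \<ge> 2" "hd ys' = c" "last ys' = b" "sorted_wrt (<) ys'"
      "\<forall>i < length ys' - 1. \<exists>c\<in>S. affine_on g c (ys' ! i) (ys' ! Suc i)"
    using assms(2) unfolding pw_affine_altdef by (elim exE conjE) (rule that)
  \<comment> \<open>\<open>c\<close> ends \<open>xs\<close> and begins \<open>ys'\<close>; one copy
    is dropped to keep the joined list strictly increasing.\<close>
  obtain ys where ys: "ys' = c # ys" "ys \<noteq> []"
    using ys'(1,2) by (cases ys') (auto simp: Suc_le_length_iff)
  let ?n = "length xs - 1"
  have xs_last: "xs ! ?n = c"
    using xs(1,3) by (subst last_conv_nth[symmetric]) auto
  \<comment> \<open>The copy of \<open>c\<close> kept at index \<open>?n\<close> doubles as entry 0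
    of \<open>ys'\<close>, hence the offset \<open>?n\<close> and not
    \<open>length xs\<close>.\<close>
  have right: "(xs @ ys) ! (?n + j) = ys' ! j" if "j < length ys'" for j
    using xs(1) xs_last ys that by (cases j) (auto simp: nth_append)
  have le: "x \<le> c" if x: "x \<in> set xs" for x
  proof -
    have "xs = butlast xs @ [c]"
      using xs(1,3) by (metis append_butlast_last_id length_0_conv not_numeral_le_zero)
    then have "sorted_wrt (<) (butlast xs @ [c])" "x \<in> set (butlast xs @ [c])"
      using xs(4) x by metis+
    then show ?thesis
      by (auto simp: sorted_wrt_append)
  qed
  have "\<exists>c\<in>S. affine_on g c ((xs @ ys) ! i) ((xs @ ys) ! Suc i)"
    if i: "i < length (xs @ ys) - 1" for i
  proof (cases "i < ?n")
    case True
    then have "i < length xs" "Suc i < length xs" by auto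
    with True show ?thesis using xs(5) by (simp add: nth_append)
  next
    case False
    then obtain j where j: "i = ?n + j" by (metis le_add_diff_inverse not_less)
    then have "j < length ys' - 1"
      using i xs(1) ys by auto
    then show ?thesis
      using ys'(5)[rule_format, of j] right[of j] right[of "Suc j"] unfolding j by simp
  qed
  moreover have "sorted_wrt (<) (xs @ ys)"
    using xs(4) ys'(4) ys le by (fastforce simp: sorted_wrt_append)
  moreover have "hd (xs @ ys) = a" "last (xs @ ys) = b"
    using xs ys ys' by (auto simp: hd_append)
  ultimately show ?thesis
    using xs(1) unfolding pw_affine_altdef
    by (intro exI[of _ "xs @ ys"]) auto
qed

lemma affine_on_imp_pw_affine:
  assumes "u < v" "c \<in> S" "affine_on g c u v"
  shows "pw_affine S g u v"
  unfolding pw_affine_altdef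
  using assms by (intro exI[of _ "[u, v]"]) auto

text \<open>The bridge between breakpoints and germs; from right to left it is the compactness
  argument of \<open>locally_affine_induct\<close>.\<close>

lemma pw_affine_iff: "pw_affine S g a b \<longleftrightarrow> a < b \<and> locally_affine S g a b"
proof
  assume "a < b \<and> locally_affine S g a b"
  then have "a < b" "locally_affine S g a b" "locally_affine S g a b" by auto
  then show "pw_affine S g a b"
  proof (induction rule: locally_affine_induct)
    case (affine u v c d)
    then show ?case using affine_on_imp_pw_affine by blast
  next
    case (glue u v w)
    then show ?case using pw_affine_glue by blast
  qed
qed (auto intro: pw_affine_imp_less pw_affine_imp_locally_affine)

lemma locally_affine_mono: "locally_affine S g a b \<Longrightarrow> S \<subseteq> T \<Longrightarrow> locally_affine T g a b"
  unfolding locally_affine_def by blast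

lemma locally_affine_lincomb:
  assumes "locally_affine UNIV f u v" "locally_affine UNIV g u v"
  shows "locally_affine UNIV (\<lambda>t. a * f t + b * g t) u v"
  using assms affine_right_lincomb affine_left_lincomb unfolding locally_affine_def by (metis UNIV_I)

text \<open>A truncated germ keeps its slope or becomes flat, hence \<open>0 \<in> S\<close>. With
  integer slopes this keeps \<open>min f k\<close> inside \<open>RG G\<close>.\<close>

lemma locally_affine_min:
  assumes "locally_affine S f u v" "0 \<in> S"
  shows "locally_affine S (\<lambda>t. min (f t) k) u v"
proof -
  have "\<exists>c\<in>S. affine_right (\<lambda>t. min (f t) k) x c" if "c \<in> S" "affine_right f x c" for c x
    using affine_right_min[OF that(2), of k] that(1) \<open>0 \<in> S\<close> by (auto simp: min_def split: if_splits)
  moreover have "\<exists>c\<in>S. affine_left (\<lambda>t. min (f t) k) x c" if "c \<in> S" "affine_left f x c" for c x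
    using affine_left_min[OF that(2), of k] that(1) \<open>0 \<in> S\<close> by (auto simp: max_def split: if_splits)
  ultimately show ?thesis
    using assms(1) unfolding locally_affine_def by blast
qed

section \<open>The Dirichlet form of an interval\<close>

definition kinks :: "(real \<Rightarrow> real) \<Rightarrow> real \<Rightarrow> real \<Rightarrow> real set" where
  "kinks f a b = {t. a < t \<and> t < b \<and> rslope f t \<noteq> lslope f t}"

text \<open>This is \<open>\<integral> f' g'\<close> over \<open>[a, b]\<close> after integration by parts, so its symmetry is a theorem.\<close>

definition dirichlet :: "(real \<Rightarrow> real) \<Rightarrow> (real \<Rightarrow> real) \<Rightarrow> real \<Rightarrow> real \<Rightarrow> real" where
  "dirichlet f g a b = lslope f b * g b - rslope f a * g a
     - (\<Sum>t\<in>kinks f a b. (rslope f t - lslope f t) * g t)"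

lemma kinks_affine:
  assumes "affine_on f c u v"
  shows "kinks f u v = {}"
proof -
  have "rslope f t = c \<and> lslope f t = c" if "u < t" "t < v" for t
    using rslope_eq[OF affine_on_imp_right[OF assms, of t]] lslope_eq[OF affine_on_imp_left[OF assms, of t]] that
    by simp
  then show ?thesis by (auto simp: kinks_def)
qed

text \<open>Source of both symmetry and positivity: on a common affine piece the form is slope times
  slope times length.\<close>

lemma dirichlet_affine:
  assumes "affine_on f c u v" "affine_on g d u v" "u < v"
  shows "dirichlet f g u v = c * d * (v - u)"
proof -
  have "rslope f u = c" "lslope f v = c"
    using assms by (auto intro!: rslope_eq lslope_eq affine_on_imp_right affine_on_imp_left)
  then have "dirichlet f g u v = c * (g v - g u)"
    using kinks_affine[OF assms(1)] by (simp add: dirichlet_def right_diff_distrib)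
  moreover have "g v - g u = d * (v - u)"
    using affine_onD[OF assms(2), of v] \<open>u < v\<close> by simp
  ultimately show ?thesis by simp
qed

lemma kinks_glue_finite:
  assumes "u < v" "v < w" "finite (kinks f u v)" "finite (kinks f v w)"
  shows "finite (kinks f u w)"
proof (rule finite_subset)
  show "kinks f u w \<subseteq> insert v (kinks f u v \<union> kinks f v w)"
    by (auto simp: kinks_def)
qed (use assms in auto)

text \<open>The two boundary terms at \<open>v\<close> combine into exactly the kink term that
  \<open>v\<close> contributes to the longer interval.\<close>

lemma dirichlet_glue:
  assumes "u < v" "v < w" "finite (kinks f u v)" "finite (kinks f v w)"
  shows "dirichlet f g u w = dirichlet f g u v + dirichlet f g v w"
proof -
  let ?k = "\<lambda>t. (rslope f t - lslope f t) * g t"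
  let ?A = "kinks f u v" and ?B = "kinks f v w"
  \<comment> \<open>\<open>v\<close> is inserted even if it is no kink; its term is then
    zero.\<close>
  have "sum ?k (kinks f u w) = sum ?k (insert v (?A \<union> ?B))"
    using assms by (intro sum.mono_neutral_left) (auto simp: kinks_def)
  also have "\<dots> = ?k v + sum ?k (?A \<union> ?B)"
    using assms by (intro sum.insert) (auto simp: kinks_def)
  also have "sum ?k (?A \<union> ?B) = sum ?k ?A + sum ?k ?B"
    using assms by (intro sum.union_disjoint) (auto simp: kinks_def)
  finally show ?thesis by (simp add: dirichlet_def algebra_simps)
qed

lemma finite_kinks:
  assumes "a < b" "locally_affine S f a b"
  shows "finite (kinks f a b)"
  using assms(1,2,2)
proof (induction rule: locally_affine_induct)
  case (affine u v c d)
  then show ?case by (simp add: kinks_affine)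
next
  case (glue u v w)
  then show ?case using kinks_glue_finite by blast
qed

lemma dirichlet_commute:
  assumes "a < b" "locally_affine S f a b" "locally_affine T g a b"
  shows "dirichlet f g a b = dirichlet g f a b"
proof -
  \<comment> \<open>Finiteness travels through the induction because \<open>dirichlet_glue\<close>
    requires it.\<close>
  have "finite (kinks f a b) \<and> finite (kinks g a b) \<and> dirichlet f g a b = dirichlet g f a b"
    using assms
  proof (induction rule: locally_affine_induct)
    case (affine u v c d)
    then show ?case by (simp add: kinks_affine dirichlet_affine)
  next
    case (glue u v w)
    then show ?case by (auto simp: dirichlet_glue intro: kinks_glue_finite)
  qed
  then show ?thesis by blast
qed

lemma dirichlet_self:
  assumes "a < b" "locally_affine S f a b"
  shows "dirichlet f f a b \<ge> 0" (is ?nonneg)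
    and "dirichlet f f a b = 0 \<Longrightarrow> \<exists>k. \<forall>t\<in>{a..b}. f t = k" (is "_ \<Longrightarrow> ?const")
proof -
  have "finite (kinks f a b) \<and> dirichlet f f a b \<ge> 0
      \<and> (dirichlet f f a b = 0 \<longrightarrow> (\<exists>k. \<forall>t\<in>{a..b}. f t = k))"
    using assms(1,2,2)
  proof (induction rule: locally_affine_induct)
    case (affine u v c d)
    then have *: "dirichlet f f u v = c * c * (v - u)"
      using dirichlet_affine by blast
    have "\<exists>k. \<forall>t\<in>{u..v}. f t = k" if "c = 0"
    proof -
      have "f t = f u" if "t \<in> {u..v}" for t
        using affine_onD[OF affine(6), of t] that \<open>c = 0\<close> by simp
      then show ?thesis by blast
    qed
    with * show ?case
      using affine by (simp add: kinks_affine)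
  next
    case (glue u v w)
    have *: "dirichlet f f u w = dirichlet f f u v + dirichlet f f v w"
      using glue by (intro dirichlet_glue) auto
    have "\<exists>k. \<forall>t\<in>{u..w}. f t = k" if "dirichlet f f u w = 0"
    proof -
      \<comment> \<open>Two nonnegative forms with sum zero both vanish; the two constants then
        agree at the common point \<open>v\<close>.\<close>
      have "dirichlet f f u v = 0" "dirichlet f f v w = 0"
        using that * glue by auto
      then obtain k l where k: "\<forall>t\<in>{u..v}. f t = k" and l: "\<forall>t\<in>{v..w}. f t = l"
        using glue by blast
      have "k = l"
        using bspec[OF k, of v] bspec[OF l, of v] glue by simp
      then have "f t = k" if "t \<in> {u..w}" for t
        using that k l by (cases "t \<le> v") auto
      then show ?thesis by blast
    qed
    then show ?case
      using glue * kinks_glue_finite[of u v w f] by simp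
  qed
  then show ?nonneg "dirichlet f f a b = 0 \<Longrightarrow> ?const" by blast+
qed

section \<open>Linear algebra\<close>

text \<open>Fredholm alternative. In the induction step either the new column lies in the span of the old
  ones, or it can be used to correct both \<open>b\<close> and the annihilating functional.\<close>

lemma fredholm_alternative:
  fixes c :: "'j \<Rightarrow> 'v \<Rightarrow> real"
  assumes "finite J" "finite V"
  shows "(\<exists>x. \<forall>v\<in>V. b v = (\<Sum>j\<in>J. x j * c j v)) \<or>
         (\<exists>y. (\<forall>j\<in>J. (\<Sum>v\<in>V. y v * c j v) = 0) \<and> (\<Sum>v\<in>V. y v * b v) \<noteq> 0)"
  using assms(1)
proof (induction J arbitrary: b)
  case empty
  show ?case
  proof (cases "\<forall>v\<in>V. b v = 0")
    case False
    then have "(\<Sum>v\<in>V. b v * b v) \<noteq> 0"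
      using \<open>finite V\<close> by (simp add: sum_nonneg_eq_0_iff)
    then show ?thesis by auto
  qed simp
next
  case (insert j J)
  define dot where "dot y a = (\<Sum>v\<in>V. y v * a v)" for y a :: "'v \<Rightarrow> real"
  have dot_diff_left: "dot (\<lambda>v. y v - s * z v) a = dot y a - s * dot z a" for y s z a
    by (simp add: dot_def left_diff_distrib sum_subtractf sum_distrib_left mult.assoc)
  have dot_diff_right: "dot y (\<lambda>v. a v - s * a' v) = dot y a - s * dot y a'" for y s a a'
    by (simp add: dot_def right_diff_distrib sum_subtractf sum_distrib_left mult.left_commute)
  have upd: "(\<Sum>k\<in>insert j J. (x(j := s)) k * c k v) = s * c j v + (\<Sum>k\<in>J. x k * c k v)" for x s v
  proof -
    have "(\<Sum>k\<in>J. (x(j := s)) k * c k v) = (\<Sum>k\<in>J. x k * c k v)"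
      using insert by (intro sum.cong) auto
    with insert show ?thesis by simp
  qed
  from insert.IH[of "c j"] show ?case
  proof
    assume "\<exists>x. \<forall>v\<in>V. c j v = (\<Sum>k\<in>J. x k * c k v)"
    then obtain x where x: "\<And>v. v \<in> V \<Longrightarrow> c j v = (\<Sum>k\<in>J. x k * c k v)" by blast
    from insert.IH[of b] show ?case
    proof
      assume "\<exists>x. \<forall>v\<in>V. b v = (\<Sum>k\<in>J. x k * c k v)"
      then obtain x where "\<And>v. v \<in> V \<Longrightarrow> b v = (\<Sum>k\<in>J. x k * c k v)" by blast
      then show ?case
        using upd[of x 0] by (intro disjI1 exI[of _ "x(j := 0)"]) simp
    next
      assume "\<exists>y. (\<forall>k\<in>J. (\<Sum>v\<in>V. y v * c k v) = 0) \<and> (\<Sum>v\<in>V. y v * b v) \<noteq> 0"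
      then obtain y where y: "\<And>k. k \<in> J \<Longrightarrow> dot y (c k) = 0" "dot y b \<noteq> 0"
        by (auto simp: dot_def)
      \<comment> \<open>\<open>c j\<close> is a combination of the old columns, so \<open>y\<close>
        annihilates it as well.\<close>
      have "dot y (c j) = (\<Sum>v\<in>V. \<Sum>k\<in>J. x k * (y v * c k v))"
        unfolding dot_def by (intro sum.cong refl) (simp add: x sum_distrib_left mult_ac)
      also have "\<dots> = (\<Sum>k\<in>J. x k * dot y (c k))"
        unfolding dot_def by (subst sum.swap) (simp add: sum_distrib_left)
      also have "\<dots> = 0" using y by simp
      finally show ?case
        using y unfolding dot_def by (intro disjI2 exI[of _ y]) auto
    qed
  next
    assume "\<exists>y. (\<forall>k\<in>J. (\<Sum>v\<in>V. y v * c k v) = 0) \<and> (\<Sum>v\<in>V. y v * c j v) \<noteq> 0"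
    then obtain z where z: "\<And>k. k \<in> J \<Longrightarrow> dot z (c k) = 0" "dot z (c j) \<noteq> 0"
      by (auto simp: dot_def)
    \<comment> \<open>Applying \<open>z\<close> to a solution forces this coefficient of
      \<open>c j\<close>, since \<open>z\<close> annihilates the other columns.\<close>
    define s where "s = dot z b / dot z (c j)"
    from insert.IH[of "\<lambda>v. b v - s * c j v"] show ?case
    proof
      assume "\<exists>x. \<forall>v\<in>V. b v - s * c j v = (\<Sum>k\<in>J. x k * c k v)"
      then obtain x where x: "\<And>v. v \<in> V \<Longrightarrow> b v - s * c j v = (\<Sum>k\<in>J. x k * c k v)" by blast
      have "b v = (\<Sum>k\<in>insert j J. (x(j := s)) k * c k v)" if "v \<in> V" for v
        unfolding upd x[OF that, symmetric] by simp
      then show ?case by blast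
    next
      assume "\<exists>y. (\<forall>k\<in>J. (\<Sum>v\<in>V. y v * c k v) = 0) \<and> (\<Sum>v\<in>V. y v * (b v - s * c j v)) \<noteq> 0"
      then obtain y where y: "\<And>k. k \<in> J \<Longrightarrow> dot y (c k) = 0" "dot y (\<lambda>v. b v - s * c j v) \<noteq> 0"
        by (auto simp: dot_def)
      define y' where "y' = (\<lambda>v. y v - (dot y (c j) / dot z (c j)) * z v)"
      have "dot y' (c k) = 0" if "k \<in> insert j J" for k
        using that y z unfolding y'_def dot_diff_left by auto
      \<comment> \<open>\<open>dot y' b\<close> equals the nonzero
        \<open>dot y (\<lambda>v. b v - s * c j v)\<close>: the correction is moved from
        \<open>b\<close> to \<open>y\<close>.\<close>
      moreover have "dot y' b \<noteq> 0"
        using y(2) z(2) unfolding y'_def dot_diff_left dot_diff_right s_def by (simp add: field_simps)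
      ultimately show ?case
        unfolding dot_def by blast
    qed
  qed
qed

section \<open>The Laplacian of a metric graph\<close>

lemma metric_graphD:
  assumes "metric_graph G"
  shows "finite (verts G)" "finite (edges G)"
    "\<And>e. e \<in> edges G \<Longrightarrow> src G e \<in> verts G"
    "\<And>e. e \<in> edges G \<Longrightarrow> tgt G e \<in> verts G"
    "\<And>e. e \<in> edges G \<Longrightarrow> 0 < len G e"
  using assms by (auto simp: metric_graph_def)

section \<open>Function spaces and linearity of the Laplacian\<close>

lemma edgefun_0: "edgefun G f e 0 = f (Vert (src G e))"
  by (simp add: edgefun_def param_def)

lemma edgefun_len: "0 < len G e \<Longrightarrow> edgefun G f e (len G e) = f (Vert (tgt G e))"
  by (simp add: edgefun_def param_def)

lemma edgefun_inner: "0 < t \<Longrightarrow> t < len G e \<Longrightarrow> edgefun G f e t = f (Inner e t)"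
  by (simp add: edgefun_def param_def)

lemma edgefun_lincomb:
  "edgefun G (\<lambda>p. a * f p + b * g p) e = (\<lambda>t. a * edgefun G f e t + b * edgefun G g e t)"
  by (simp add: edgefun_def fun_eq_iff)

lemma edgefun_min: "edgefun G (\<lambda>p. min (f p) k) e = (\<lambda>t. min (edgefun G f e t) k)"
  by (simp add: edgefun_def fun_eq_iff)

lemma PA_iff:
  assumes "metric_graph G"
  shows "f \<in> PA G \<longleftrightarrow> (\<forall>e\<in>edges G. locally_affine UNIV (edgefun G f e) 0 (len G e))"
  using metric_graphD(5)[OF assms] by (auto simp: PA_def pw_affine_iff)

lemma RG_iff:
  assumes "metric_graph G"
  shows "f \<in> RG G \<longleftrightarrow> (\<forall>e\<in>edges G. locally_affine \<int> (edgefun G f e) 0 (len G e))"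
  using metric_graphD(5)[OF assms] by (auto simp: RG_def pw_affine_iff)

lemma RG_subset_PA: "metric_graph G \<Longrightarrow> RG G \<subseteq> PA G"
  using locally_affine_mono by (fastforce simp: PA_iff RG_iff)

lemma PA_const: "metric_graph G \<Longrightarrow> (\<lambda>_. k) \<in> PA G"
  by (auto simp: PA_iff edgefun_def locally_affine_def affine_right_def affine_left_def intro!: exI[of _ 0])

lemma PA_lincomb:
  assumes "metric_graph G" "f \<in> PA G" "g \<in> PA G"
  shows "(\<lambda>p. a * f p + b * g p) \<in> PA G"
  using assms by (simp add: PA_iff edgefun_lincomb locally_affine_lincomb)

lemma RG_min:
  assumes "metric_graph G" "f \<in> RG G"
  shows "(\<lambda>p. min (f p) k) \<in> RG G"
  using assms by (simp add: RG_iff edgefun_min locally_affine_min)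

lemma Delta_invalid: "\<not> valid G p \<Longrightarrow> Delta G f p = 0"
  by (cases p) auto

text \<open>Constancy is asked on valid points only, because
  \<open>dirichlet_form_eq_0_imp_const\<close> says nothing about the others.\<close>

lemma Delta_const:
  assumes G: "metric_graph G" and f: "\<And>p. valid G p \<Longrightarrow> f p = k"
  shows "Delta G f p = 0"
proof -
  have f_edge: "edgefun G f e t = k" if "e \<in> edges G" "0 \<le> t" "t \<le> len G e" for e t
    using that by (auto simp: edgefun_def param_def metric_graphD[OF G] intro!: f)
  then have aff: "affine_on (edgefun G f e) 0 0 (len G e)" if "e \<in> edges G" for e
    using that by (simp add: affine_on_def)
  have "rslope (edgefun G f e) t = 0" if "e \<in> edges G" "0 \<le> t" "t < len G e" for e t
    using affine_on_imp_right[OF aff] that by (intro rslope_eq) auto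
  moreover have "lslope (edgefun G f e) t = 0" if "e \<in> edges G" "0 < t" "t \<le> len G e" for e t
    using affine_on_imp_left[OF aff] that by (intro lslope_eq) auto
  ultimately show ?thesis
    by (cases p) (auto simp: metric_graphD[OF G])
qed

lemma rslope_lincomb:
  assumes "locally_affine UNIV f u v" "locally_affine UNIV g u v" "u \<le> x" "x < v"
  shows "rslope (\<lambda>t. a * f t + b * g t) x = a * rslope f x + b * rslope g x"
proof -
  obtain c d where "affine_right f x c" "affine_right g x d"
    using assms unfolding locally_affine_def by blast
  then show ?thesis
    using affine_right_lincomb[of f x c g d a b] by (simp add: rslope_eq)
qed

lemma lslope_lincomb:
  assumes "locally_affine UNIV f u v" "locally_affine UNIV g u v" "u < x" "x \<le> v"
  shows "lslope (\<lambda>t. a * f t + b * g t) x = a * lslope f x + b * lslope g x"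
proof -
  obtain c d where "affine_left f x c" "affine_left g x d"
    using assms unfolding locally_affine_def by blast
  then show ?thesis
    using affine_left_lincomb[of f x c g d a b] by (simp add: lslope_eq)
qed

lemma Delta_lincomb:
  assumes G: "metric_graph G" and "f \<in> PA G" "g \<in> PA G"
  shows "Delta G (\<lambda>p. a * f p + b * g p) p = a * Delta G f p + b * Delta G g p"
proof -
  let ?h = "\<lambda>p. a * f p + b * g p"
  note h = edgefun_lincomb[of G a f b g]
  have f: "locally_affine UNIV (edgefun G f e) 0 (len G e)"
    and g: "locally_affine UNIV (edgefun G g e) 0 (len G e)" if "e \<in> edges G" for e
    using assms that by (auto simp: PA_iff)
  have r: "rslope (edgefun G ?h e) t = a * rslope (edgefun G f e) t + b * rslope (edgefun G g e) t"
    if "e \<in> edges G" "0 \<le> t" "t < len G e" for e t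
    using rslope_lincomb[OF f g] that by (simp add: h)
  have l: "lslope (edgefun G ?h e) t = a * lslope (edgefun G f e) t + b * lslope (edgefun G g e) t"
    if "e \<in> edges G" "0 < t" "t \<le> len G e" for e t
    using lslope_lincomb[OF f g] that by (simp add: h)
  show ?thesis
  proof (cases p)
    case (Vert v)
    have "(\<Sum>e\<in>{e\<in>edges G. src G e = v}. rslope (edgefun G ?h e) 0)
        = (\<Sum>e\<in>{e\<in>edges G. src G e = v}. a * rslope (edgefun G f e) 0 + b * rslope (edgefun G g e) 0)"
      by (intro sum.cong) (auto simp: r metric_graphD[OF G])
    moreover have "(\<Sum>e\<in>{e\<in>edges G. tgt G e = v}. lslope (edgefun G ?h e) (len G e))
        = (\<Sum>e\<in>{e\<in>edges G. tgt G e = v}. a * lslope (edgefun G f e) (len G e) + b * lslope (edgefun G g e) (len G e))"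
      by (intro sum.cong) (auto simp: l metric_graphD[OF G])
    ultimately show ?thesis
      by (simp add: Vert sum.distrib sum_distrib_left[symmetric] right_diff_distrib)
  next
    case (Inner e t)
    then show ?thesis
      by (auto simp: r l algebra_simps)
  qed
qed

lemma PA_sum:
  assumes G: "metric_graph G" and "finite J" "\<And>j. j \<in> J \<Longrightarrow> \<phi> j \<in> PA G"
  shows "(\<lambda>p. \<Sum>j\<in>J. x j * \<phi> j p) \<in> PA G \<and>
         (\<forall>p. Delta G (\<lambda>p. \<Sum>j\<in>J. x j * \<phi> j p) p = (\<Sum>j\<in>J. x j * Delta G (\<phi> j) p))"
  using assms(2,3)
proof (induction J)
  case empty
  then show ?case using PA_const[OF G, of 0] Delta_const[OF G, of "\<lambda>_. 0" 0] by (simp del: Delta.simps)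
next
  case (insert j J)
  then have "\<phi> j \<in> PA G" and IH: "(\<lambda>p. \<Sum>j\<in>J. x j * \<phi> j p) \<in> PA G"
    by auto
  from PA_lincomb[OF G this, of "x j" 1] Delta_lincomb[OF G this, of "x j" 1] show ?case
    using insert by simp
qed

section \<open>Green's identity, symmetry and positive definiteness\<close>

definition dirichlet_form :: "('v, 'e) mgraph \<Rightarrow> (('v, 'e) pt \<Rightarrow> real) \<Rightarrow> (('v, 'e) pt \<Rightarrow> real) \<Rightarrow> real" where
  "dirichlet_form G f g = (\<Sum>e\<in>edges G. dirichlet (edgefun G f e) (edgefun G g e) 0 (len G e))"

lemma
  assumes G: "metric_graph G" and f: "f \<in> PA G"
  shows finite_Delta_support: "finite {p. Delta G f p \<noteq> 0}"
    and green_identity: "\<lbrakk>finite A; {p. Delta G f p \<noteq> 0} \<subseteq> A\<rbrakk> \<Longrightarrow>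
      (\<Sum>p\<in>A. Delta G f p * g p) = dirichlet_form G f g"
proof -
  note [simp] = metric_graphD[OF G]
  let ?f = "edgefun G f" and ?g = "edgefun G g"
  define K where "K e = kinks (?f e) 0 (len G e)" for e
  have finK: "finite (K e)" if "e \<in> edges G" for e
    using that f unfolding K_def by (auto simp: PA_iff[OF G] intro: finite_kinks)
  define B where "B = (SIGMA e:edges G. K e)"
  let ?I = "(\<lambda>(e, t). Inner e t) ` B"
  have supp: "{p. Delta G f p \<noteq> 0} \<subseteq> Vert ` verts G \<union> ?I"
  proof
    fix p assume "p \<in> {p. Delta G f p \<noteq> 0}"
    then show "p \<in> Vert ` verts G \<union> ?I"
      by (cases p) (auto simp: B_def K_def kinks_def image_iff split: if_splits)
  qed
  have fin: "finite (Vert ` verts G \<union> ?I)"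
    using finK by (simp add: B_def)
  show "finite {p. Delta G f p \<noteq> 0}"
    using finite_subset[OF supp fin] .
  assume A: "finite A" "{p. Delta G f p \<noteq> 0} \<subseteq> A"
  have "(\<Sum>p\<in>A. Delta G f p * g p) = (\<Sum>p\<in>{p. Delta G f p \<noteq> 0}. Delta G f p * g p)"
    using A by (intro sum.mono_neutral_right) auto
  also have "\<dots> = (\<Sum>p\<in>Vert ` verts G \<union> ?I. Delta G f p * g p)"
    using fin supp by (intro sum.mono_neutral_left) auto
  also have "\<dots> = (\<Sum>p\<in>Vert ` verts G. Delta G f p * g p) + (\<Sum>p\<in>?I. Delta G f p * g p)"
    using fin by (intro sum.union_disjoint) auto
  also have "(\<Sum>p\<in>?I. Delta G f p * g p) = (\<Sum>(e, t)\<in>B. Delta G f (Inner e t) * g (Inner e t))"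
    by (subst sum.reindex) (auto simp: inj_on_def intro!: sum.cong)
  also have "\<dots> = (\<Sum>e\<in>edges G. \<Sum>t\<in>K e. Delta G f (Inner e t) * g (Inner e t))"
    unfolding B_def using finK by (subst sum.Sigma) auto
  also have "\<dots> = (\<Sum>e\<in>edges G. - (\<Sum>t\<in>K e. (rslope (?f e) t - lslope (?f e) t) * ?g e t))"
    unfolding sum_negf[symmetric]
    by (intro sum.cong refl) (auto simp: K_def kinks_def edgefun_inner algebra_simps)
  also have "(\<Sum>p\<in>Vert ` verts G. Delta G f p * g p) = (\<Sum>v\<in>verts G. Delta G f (Vert v) * g (Vert v))"
    by (subst sum.reindex) (auto simp: inj_on_def)
  also have "\<dots> = (\<Sum>v\<in>verts G. (\<Sum>e\<in>{e\<in>edges G. tgt G e = v}. lslope (?f e) (len G e) * ?g e (len G e))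
        - (\<Sum>e\<in>{e\<in>edges G. src G e = v}. rslope (?f e) 0 * ?g e 0))"
  proof (intro sum.cong refl)
    fix v assume "v \<in> verts G"
    have "(\<Sum>e\<in>{e\<in>edges G. tgt G e = v}. lslope (?f e) (len G e) * ?g e (len G e))
        = (\<Sum>e\<in>{e\<in>edges G. tgt G e = v}. lslope (?f e) (len G e)) * g (Vert v)"
      unfolding sum_distrib_right by (intro sum.cong) (auto simp: edgefun_len)
    moreover have "(\<Sum>e\<in>{e\<in>edges G. src G e = v}. rslope (?f e) 0 * ?g e 0)
        = (\<Sum>e\<in>{e\<in>edges G. src G e = v}. rslope (?f e) 0) * g (Vert v)"
      unfolding sum_distrib_right by (intro sum.cong) (auto simp: edgefun_0)
    ultimately show "Delta G f (Vert v) * g (Vert v)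
        = (\<Sum>e\<in>{e\<in>edges G. tgt G e = v}. lslope (?f e) (len G e) * ?g e (len G e))
        - (\<Sum>e\<in>{e\<in>edges G. src G e = v}. rslope (?f e) 0 * ?g e 0)"
      using \<open>v \<in> verts G\<close> by (simp add: left_diff_distrib)
  qed
  \<comment> \<open>Each edge has exactly one source and one target among the vertices, so
    regrouping by edges counts each end once; a loop contributes both terms at the same
    vertex.\<close>
  also have "\<dots> = (\<Sum>e\<in>edges G. lslope (?f e) (len G e) * ?g e (len G e)) - (\<Sum>e\<in>edges G. rslope (?f e) 0 * ?g e 0)"
    unfolding sum_subtractf by (intro arg_cong2[of _ _ _ _ "(-)"] sum.group) auto
  finally show "(\<Sum>p\<in>A. Delta G f p * g p) = dirichlet_form G f g"
    by (simp add: dirichlet_form_def dirichlet_def K_def sum_subtractf sum_negf)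
qed

lemma dirichlet_form_commute:
  assumes "metric_graph G" "f \<in> PA G" "g \<in> PA G"
  shows "dirichlet_form G f g = dirichlet_form G g f"
  unfolding dirichlet_form_def
  using assms by (intro sum.cong refl dirichlet_commute) (auto simp: PA_iff metric_graphD)

text \<open>Pair \<open>f\<close> with the constant 1 and use symmetry: the Laplacian of a constant
  vanishes.\<close>

lemma sum_Delta_eq_0:
  assumes "metric_graph G" "f \<in> PA G" "finite A" "{p. Delta G f p \<noteq> 0} \<subseteq> A"
  shows "(\<Sum>p\<in>A. Delta G f p) = 0"
proof -
  have "(\<Sum>p\<in>A. Delta G f p) = dirichlet_form G f (\<lambda>_. 1)"
    using green_identity[OF assms, of "\<lambda>_. 1"] by simp
  also have "\<dots> = dirichlet_form G (\<lambda>_. 1) f"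
    using assms by (intro dirichlet_form_commute PA_const)
  also have "\<dots> = 0"
    using green_identity[OF assms(1) PA_const[OF assms(1)], of "{}" 1 f]
      Delta_const[OF assms(1), of "\<lambda>_. 1" 1] by simp
  finally show ?thesis .
qed

lemma dirichlet_form_nonneg:
  assumes "metric_graph G" "f \<in> PA G"
  shows "dirichlet_form G f f \<ge> 0"
  unfolding dirichlet_form_def
  using assms by (intro sum_nonneg dirichlet_self) (auto simp: PA_iff metric_graphD)

text \<open>Every edge form is nonnegative, so all vanish and \<open>f\<close> is constant along
  each closed edge; walks between vertices carry the value through the connected graph.\<close>

lemma dirichlet_form_eq_0_imp_const:
  assumes G: "metric_graph G" and f: "f \<in> PA G" and 0: "dirichlet_form G f f = 0"
    and p: "valid G p" and q: "valid G q"
  shows "f p = f q"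
proof -
  note [simp] = metric_graphD[OF G]
  have aff: "locally_affine UNIV (edgefun G f e) 0 (len G e)" if "e \<in> edges G" for e
    using f that by (simp add: PA_iff[OF G])
  have "\<exists>k. \<forall>t\<in>{0..len G e}. edgefun G f e t = k" if "e \<in> edges G" for e
  proof (rule dirichlet_self(2))
    show "dirichlet (edgefun G f e) (edgefun G f e) 0 (len G e) = 0"
      using 0 that unfolding dirichlet_form_def
      by (subst (asm) sum_nonneg_eq_0_iff) (auto intro: dirichlet_self aff)
  qed (use that aff in auto)
  then obtain k where k: "\<And>e t. e \<in> edges G \<Longrightarrow> 0 \<le> t \<Longrightarrow> t \<le> len G e \<Longrightarrow> edgefun G f e t = k e"
    by (metis atLeastAtMost_iff)
  have edge: "f (Vert (src G e)) = k e" "f (Vert (tgt G e)) = k e" if "e \<in> edges G" for e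
    using k[OF that, of 0] k[OF that, of "len G e"] that
    by (simp_all add: edgefun_0 edgefun_len less_imp_le)
  have vert: "f (Vert u) = f (Vert v)" if "u \<in> verts G" "v \<in> verts G" for u v
  proof -
    have "(u, v) \<in> ({(src G e, tgt G e) | e. e \<in> edges G} \<union> {(tgt G e, src G e) | e. e \<in> edges G})\<^sup>*"
      using G that by (simp add: metric_graph_def)
    then show ?thesis
      by (induction rule: rtrancl_induct) (auto simp: edge)
  qed
  have "\<exists>v\<in>verts G. f p = f (Vert v)" if "valid G p" for p
  proof (cases p)
    case (Inner e t)
    with that have "f p = k e"
      using k[of e t] by (simp add: edgefun_inner)
    then show ?thesis
      using edge(1)[of e] Inner that by (intro bexI[of _ "src G e"]) auto
  qed (use that in auto)
  with p q vert show ?thesis by metis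
qed

section \<open>Existence of potentials\<close>

text \<open>Vertex data extended without kinks inside edges: the Laplacian then lives on vertices,
  and the Poisson equation there becomes a finite linear system.\<close>

definition linear_extension :: "('v, 'e) mgraph \<Rightarrow> ('v \<Rightarrow> real) \<Rightarrow> ('v, 'e) pt \<Rightarrow> real" where
  "linear_extension G x p = (case p of Vert v \<Rightarrow> x v
     | Inner e t \<Rightarrow> x (src G e) + (x (tgt G e) - x (src G e)) / len G e * t)"

lemma
  assumes G: "metric_graph G"
  shows linear_extension_PA: "linear_extension G x \<in> PA G"
    and Delta_linear_extension_Inner: "Delta G (linear_extension G x) (Inner e t) = 0"
proof -
  note [simp] = metric_graphD[OF G]
  have aff: "affine_on (edgefun G (linear_extension G x) e) ((x (tgt G e) - x (src G e)) / len G e) 0 (len G e)"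
    if "e \<in> edges G" for e
  proof -
    have "edgefun G (linear_extension G x) e t = x (src G e) + (x (tgt G e) - x (src G e)) / len G e * t"
      if "0 \<le> t" "t \<le> len G e" for t
      using that \<open>e \<in> edges G\<close> metric_graphD(5)[OF G \<open>e \<in> edges G\<close>]
      by (auto simp: edgefun_def param_def linear_extension_def)
    then show ?thesis
      unfolding affine_on_def by (auto simp: edgefun_0 linear_extension_def)
  qed
  show "linear_extension G x \<in> PA G"
    unfolding PA_def using aff by (auto intro!: affine_on_imp_pw_affine)
  show "Delta G (linear_extension G x) (Inner e t) = 0"
    using kinks_affine[OF aff] by (auto simp: kinks_def)
qed

text \<open>The Green's function of one edge with zero boundary values, scaled by the edge length.
  Its slopes are \<open>len G e - t\<close> before \<open>t\<close> and \<open>- t\<close> after it,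
  so the mass at \<open>t\<close> is \<open>len G e\<close>.\<close>

definition tent :: "('v, 'e) mgraph \<Rightarrow> 'e \<Rightarrow> real \<Rightarrow> ('v, 'e) pt \<Rightarrow> real" where
  "tent G e t p = (case p of Vert _ \<Rightarrow> 0
     | Inner e' s \<Rightarrow> if e' = e then min (s * (len G e - t)) (t * (len G e - s)) else 0)"

lemma
  assumes G: "metric_graph G" and et: "valid G (Inner e t)"
  shows tent_PA: "tent G e t \<in> PA G"
    and Delta_tent_Inner: "Delta G (tent G e t) (Inner e' s) = (if e' = e \<and> s = t then len G e else 0)"
proof -
  note [simp] = metric_graphD[OF G]
  let ?L = "len G e" and ?h = "edgefun G (tent G e t)"
  have e: "e \<in> edges G" "0 < t" "t < ?L" using et by auto
  \<comment> \<open>At \<open>s = 0\<close> and \<open>s = ?L\<close> the minimum equals the value 0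
    assigned to vertices: this is the continuity of the tent.\<close>
  have h: "?h e s = min (s * (?L - t)) (t * (?L - s))" if "0 \<le> s" "s \<le> ?L" for s
    using that e by (auto simp: edgefun_def param_def tent_def min_def not_le mult_less_0_iff)
  have iff: "s * (?L - t) \<le> t * (?L - s) \<longleftrightarrow> s \<le> t" for s
    using e by (simp add: algebra_simps)
  have left: "affine_on (?h e) (?L - t) 0 t"
    using e by (auto simp: affine_on_def h iff min_def)
  have right: "affine_on (?h e) (- t) t ?L"
    using e by (auto simp: affine_on_def h iff min_def algebra_simps)
  have other: "affine_on (?h e') 0 0 (len G e')" if "e' \<noteq> e" for e'
    using that by (auto simp: affine_on_def edgefun_def param_def tent_def)
  have "pw_affine UNIV (?h e) 0 ?L"
    using e left right by (intro pw_affine_glue[of _ _ 0 t ?L] affine_on_imp_pw_affine) auto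
  moreover have "pw_affine UNIV (?h e') 0 (len G e')" if "e' \<in> edges G" "e' \<noteq> e" for e'
    using that by (intro affine_on_imp_pw_affine[OF _ _ other]) auto
  ultimately show "tent G e t \<in> PA G"
    unfolding PA_def by fast
  show "Delta G (tent G e t) (Inner e' s) = (if e' = e \<and> s = t then len G e else 0)"
  proof (cases "e' = e")
    case False
    then show ?thesis
      using kinks_affine[OF other[OF False]] by (auto simp: kinks_def)
  next
    case True
    consider "s < t" | "s = t" | "t < s" by linarith
    then show ?thesis
    proof cases
      case 1
      then show ?thesis using True kinks_affine[OF left] by (auto simp: kinks_def)
    next
      case 2
      have "rslope (?h e) t = - t" "lslope (?h e) t = ?L - t"
        using e by (auto intro: rslope_eq lslope_eq affine_on_imp_right[OF right] affine_on_imp_left[OF left])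
      with 2 True e show ?thesis by simp
    next
      case 3
      then show ?thesis using True kinks_affine[OF right] by (auto simp: kinks_def)
    qed
  qed
qed

text \<open>Superposes one scaled tent for each inner point of \<open>A\<close>. The mass this puts
  on vertices is uncontrolled and left to \<open>exists_Delta_eq_vertices\<close>.\<close>

lemma exists_Delta_Inner_eq:
  assumes G: "metric_graph G" and "finite A" "\<And>p. p \<in> A \<Longrightarrow> valid G p"
  shows "\<exists>h\<in>PA G. \<forall>e t. Delta G h (Inner e t) = (if Inner e t \<in> A then \<mu> (Inner e t) else 0)"
  using assms(2,3)
proof (induction A)
  case empty
  show ?case
    using PA_const[OF G, of 0] Delta_const[OF G, of "\<lambda>_. 0" 0]
    by (intro bexI[of _ "\<lambda>_. 0"]) (simp_all del: Delta.simps)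
next
  case (insert p A)
  then obtain h where h: "h \<in> PA G"
    "\<And>e t. Delta G h (Inner e t) = (if Inner e t \<in> A then \<mu> (Inner e t) else 0)"
    by auto
  show ?case
  proof (cases p)
    case (Vert v)
    with h show ?thesis by (intro bexI[of _ h]) (simp_all del: Delta.simps)
  next
    case (Inner e t)
    with insert.prems[of p] have et: "valid G (Inner e t)" by blast
    have "len G e \<noteq> 0" using et by auto
    let ?h = "\<lambda>p. 1 * h p + \<mu> (Inner e t) / len G e * tent G e t p"
    have "Delta G ?h (Inner e' s) = (if Inner e' s \<in> insert p A then \<mu> (Inner e' s) else 0)" for e' s
      unfolding Delta_lincomb[OF G h(1) tent_PA[OF G et]] Delta_tent_Inner[OF G et] h(2)
      using Inner \<open>p \<notin> A\<close> \<open>len G e \<noteq> 0\<close> by auto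
    then show ?thesis
      using PA_lincomb[OF G h(1) tent_PA[OF G et]] by blast
  qed
qed

text \<open>The columns for \<open>fredholm_alternative\<close> are the Laplacians of the hat
  functions \<open>\<phi> j\<close>. By symmetry of the form, a functional killing all columns is
  the vertex data of a harmonic function, hence constant, hence kills \<open>\<nu>\<close>
  too.\<close>

lemma exists_Delta_eq_vertices:
  assumes G: "metric_graph G"
    and supp: "\<And>p. p \<notin> Vert ` verts G \<Longrightarrow> \<nu> p = 0"
    and sum: "(\<Sum>v\<in>verts G. \<nu> (Vert v)) = 0"
  shows "\<exists>h\<in>PA G. Delta G h = \<nu>"
proof -
  define \<phi> where "\<phi> j = linear_extension G (\<lambda>v. of_bool (v = j))" for j
  have \<phi>: "\<phi> j \<in> PA G" for j
    unfolding \<phi>_def by (rule linear_extension_PA[OF G])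
  have green: "(\<Sum>v\<in>verts G. Delta G (linear_extension G x) (Vert v) * g (Vert v))
      = dirichlet_form G (linear_extension G x) g" for x g
  proof -
    have "p \<in> Vert ` verts G" if "Delta G (linear_extension G x) p \<noteq> 0" for p
    proof (cases p)
      case (Vert v)
      have "valid G p" using that by (rule contrapos_np) (rule Delta_invalid)
      with Vert show ?thesis by simp
    next
      case (Inner e t)
      with that show ?thesis by (simp add: Delta_linear_extension_Inner[OF G] del: Delta.simps)
    qed
    then have "(\<Sum>p\<in>Vert ` verts G. Delta G (linear_extension G x) p * g p)
        = dirichlet_form G (linear_extension G x) g"
      by (intro green_identity[OF G linear_extension_PA[OF G]]) (auto simp: metric_graphD[OF G] simp del: Delta.simps)
    then show ?thesis
      by (subst (asm) sum.reindex) (simp_all add: inj_on_def del: Delta.simps)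
  qed
  consider x where "\<And>v. v \<in> verts G \<Longrightarrow> \<nu> (Vert v) = (\<Sum>j\<in>verts G. x j * Delta G (\<phi> j) (Vert v))"
    | y where "\<And>j. j \<in> verts G \<Longrightarrow> (\<Sum>v\<in>verts G. y v * Delta G (\<phi> j) (Vert v)) = 0"
        "(\<Sum>v\<in>verts G. y v * \<nu> (Vert v)) \<noteq> 0"
    using fredholm_alternative[OF metric_graphD(1)[OF G] metric_graphD(1)[OF G], of "\<lambda>v. \<nu> (Vert v)" "\<lambda>j v. Delta G (\<phi> j) (Vert v)"]
    by blast
  then show ?thesis
  proof cases
    case 1
    let ?h = "\<lambda>p. \<Sum>j\<in>verts G. x j * \<phi> j p"
    note PA_sum[OF G metric_graphD(1)[OF G] \<phi>, of x]
    then have h: "?h \<in> PA G" "Delta G ?h p = (\<Sum>j\<in>verts G. x j * Delta G (\<phi> j) p)" for p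
      by (rule conjunct1, rule spec[OF conjunct2])
    have "Delta G ?h p = \<nu> p" for p
    proof (cases "p \<in> Vert ` verts G")
      case True
      then obtain v where "p = Vert v" "v \<in> verts G" by blast
      then show ?thesis by (simp only: h(2) 1)
    next
      case False
      then have "Delta G (\<phi> j) p = 0" for j
        using Delta_linear_extension_Inner[OF G] unfolding \<phi>_def
        by (cases p) (auto simp del: Delta.simps intro: Delta_invalid)
      then show ?thesis
        unfolding h(2) using supp[OF False] by simp
    qed
    then have "Delta G ?h = \<nu>" by (rule ext)
    then show ?thesis by (rule bexI[OF _ h(1)])
  next
    case 2
    let ?Y = "linear_extension G y"
    note Y = linear_extension_PA[OF G, of y]
    have "Delta G ?Y (Vert j) = 0" if j: "j \<in> verts G" for j
    proof -
      \<comment> \<open>On vertices \<open>\<phi> j\<close> is the indicator of \<open>j\<close>, so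
        pairing with it reads off the value at \<open>j\<close>; symmetry turns this into the
        pairing of \<open>y\<close> with column \<open>j\<close>.\<close>
      have "Delta G ?Y (Vert j) = (\<Sum>v\<in>verts G. Delta G ?Y (Vert v) * \<phi> j (Vert v))"
      proof -
        have "(\<Sum>v\<in>verts G. Delta G ?Y (Vert v) * \<phi> j (Vert v))
            = (\<Sum>v\<in>verts G. if v = j then Delta G ?Y (Vert v) else 0)"
          by (intro sum.cong) (simp_all add: \<phi>_def linear_extension_def del: Delta.simps)
        with j show ?thesis by (simp add: metric_graphD[OF G] del: Delta.simps)
      qed
      also have "\<dots> = dirichlet_form G ?Y (\<phi> j)"
        by (rule green)
      also have "\<dots> = dirichlet_form G (\<phi> j) ?Y"
        by (rule dirichlet_form_commute[OF G Y \<phi>])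
      also have "\<dots> = (\<Sum>v\<in>verts G. Delta G (\<phi> j) (Vert v) * ?Y (Vert v))"
        unfolding \<phi>_def by (rule green[symmetric])
      also have "\<dots> = (\<Sum>v\<in>verts G. y v * Delta G (\<phi> j) (Vert v))"
        by (intro sum.cong) (simp_all add: linear_extension_def del: Delta.simps)
      also have "\<dots> = 0" by (rule 2(1)[OF j])
      finally show ?thesis .
    qed
    then have "dirichlet_form G ?Y ?Y = 0"
      by (subst green[symmetric]) (simp del: Delta.simps)
    then have const: "y u = y v" if "u \<in> verts G" "v \<in> verts G" for u v
      using dirichlet_form_eq_0_imp_const[OF G Y _, of "Vert u" "Vert v"] that
      by (simp add: linear_extension_def)
    \<comment> \<open>If there are no vertices, \<open>k\<close> is arbitrary and the sums below are
      empty.\<close>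
    define k where "k = y (SOME v. v \<in> verts G)"
    have "y v = k" if "v \<in> verts G" for v
      unfolding k_def by (rule const[OF that someI[of "\<lambda>v. v \<in> verts G", OF that]])
    then have "(\<Sum>v\<in>verts G. y v * \<nu> (Vert v)) = k * (\<Sum>v\<in>verts G. \<nu> (Vert v))"
      unfolding sum_distrib_left by (intro sum.cong) auto
    with 2 sum show ?thesis by simp
  qed
qed

text \<open>Once \<open>\<mu>\<close> is matched inside the edges, the defect \<open>\<nu>\<close>
  lives on vertices. Laplacians have mass zero, so \<open>\<nu>\<close> does too and the vertex case
  applies.\<close>

lemma exists_Delta_eq:
  assumes G: "metric_graph G"
    and A: "finite A" "\<And>p. p \<in> A \<Longrightarrow> valid G p"
    and supp: "\<And>p. p \<notin> A \<Longrightarrow> \<mu> p = 0"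
    and sum: "(\<Sum>p\<in>A. \<mu> p) = 0"
  shows "\<exists>h\<in>PA G. Delta G h = \<mu>"
proof -
  obtain h where h: "h \<in> PA G"
    and "\<forall>e t. Delta G h (Inner e t) = (if Inner e t \<in> A then \<mu> (Inner e t) else 0)"
    using exists_Delta_Inner_eq[OF G A, of \<mu>] by (rule bexE)
  then have inner: "Delta G h (Inner e t) = \<mu> (Inner e t)" for e t
    using supp[of "Inner e t"] by (simp del: Delta.simps)
  define \<nu> where "\<nu> p = \<mu> p - Delta G h p" for p
  have \<nu>: "\<nu> p = 0" if "p \<notin> Vert ` verts G" for p
  proof (cases p)
    case (Vert v)
    with that have "\<not> valid G p" by auto
    then show ?thesis
      using supp[of p] A(2)[of p] Delta_invalid[of G p h] unfolding \<nu>_def by auto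
  next
    case (Inner e t)
    then show ?thesis
      unfolding \<nu>_def by (simp only: inner)
  qed
  define B where "B = A \<union> {p. Delta G h p \<noteq> 0} \<union> Vert ` verts G"
  have B: "finite B"
    using A finite_Delta_support[OF G h] by (simp add: B_def metric_graphD[OF G])
  have "(\<Sum>v\<in>verts G. \<nu> (Vert v)) = (\<Sum>p\<in>Vert ` verts G. \<nu> p)"
    by (subst sum.reindex) (auto simp: inj_on_def)
  also have "\<dots> = (\<Sum>p\<in>B. \<nu> p)"
    using B \<nu> by (intro sum.mono_neutral_left) (auto simp: B_def)
  also have "\<dots> = (\<Sum>p\<in>B. \<mu> p) - (\<Sum>p\<in>B. Delta G h p)"
    by (simp add: \<nu>_def sum_subtractf)
  also have "(\<Sum>p\<in>B. Delta G h p) = 0"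
    using B by (intro sum_Delta_eq_0[OF G h]) (auto simp: B_def)
  also have "(\<Sum>p\<in>B. \<mu> p) = (\<Sum>p\<in>A. \<mu> p)"
    using B supp by (intro sum.mono_neutral_right) (auto simp: B_def)
  finally have "(\<Sum>v\<in>verts G. \<nu> (Vert v)) = 0"
    using sum by simp
  then obtain k where k: "k \<in> PA G" "Delta G k = \<nu>"
    using exists_Delta_eq_vertices[of G \<nu>, OF G \<nu>] by auto
  have "Delta G (\<lambda>p. 1 * h p + 1 * k p) p = \<mu> p" for p
    unfolding Delta_lincomb[OF G h k(1)] k(2) \<nu>_def by simp
  then have "Delta G (\<lambda>p. 1 * h p + 1 * k p) = \<mu>" by (rule ext)
  then show ?thesis
    by (rule bexI[OF _ PA_lincomb[OF G h k(1)]])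
qed

section \<open>Energy and reduced divisors\<close>

text \<open>Existence of some potential is what makes the \<open>SOME\<close> in
  \<open>energy\<close> meaningful; the \<open>h\<close> obtained is the selected potential
  itself.\<close>

lemma energy_eq_dirichlet_form:
  assumes G: "metric_graph G" and ex: "\<exists>h\<in>PA G. Delta G h = \<mu>"
  obtains h where "h \<in> PA G" "Delta G h = \<mu>" "energy G \<mu> \<mu> = dirichlet_form G h h"
proof -
  define h where "h = (SOME f. f \<in> PA G \<and> (\<forall>p. valid G p \<longrightarrow> Delta G f p = \<mu> p))"
  have "\<exists>f. f \<in> PA G \<and> (\<forall>p. valid G p \<longrightarrow> Delta G f p = \<mu> p)"
    using ex by blast
  then have "h \<in> PA G \<and> (\<forall>p. valid G p \<longrightarrow> Delta G h p = \<mu> p)"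
    unfolding h_def by (rule someI_ex)
  then have h: "h \<in> PA G" "\<And>p. valid G p \<Longrightarrow> Delta G h p = \<mu> p"
    by auto
  \<comment> \<open>The choice fixes \<open>Delta G h\<close> on valid points only; elsewhere
    \<open>\<mu>\<close>, being a Laplacian, vanishes as well.\<close>
  obtain k where k: "Delta G k = \<mu>" using ex by blast
  have "Delta G h p = \<mu> p" for p
    using h(2)[of p] Delta_invalid[of G p h] Delta_invalid[of G p k] unfolding k by metis
  then have \<mu>: "Delta G h = \<mu>" ..
  have "energy G \<mu> \<mu> = (\<Sum>p | \<mu> p \<noteq> 0. \<mu> p * h p)"
    by (simp add: energy_def h_def)
  also have "\<dots> = dirichlet_form G h h"
    using green_identity[OF G h(1) finite_Delta_support[OF G h(1)] order_refl] by (simp only: \<mu>)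
  finally show thesis
    using that h(1) \<mu> by blast
qed

lemma deg_eq_sum:
  assumes "finite A" "{p. D p \<noteq> 0} \<subseteq> A"
  shows "deg D = (\<Sum>p\<in>A. D p)"
  unfolding deg_def using assms by (intro sum.mono_neutral_left) auto

text \<open>\<open>f\<close> shares its Laplacian with the difference \<open>h' - h\<close> of the
  selected potentials, and only that Laplacian is compared. \<open>A\<close> may omit
  \<open>q\<close>, where the summand vanishes.\<close>

lemma Eq_diff:
  assumes G: "metric_graph G" and q: "valid G q"
    and D: "is_div G D" and D': "is_div G D'"
    and f: "f \<in> PA G" and diff: "\<And>p. real_of_int (D' p - D p) = Delta G f p"
    and A: "finite A" "{p. D p \<noteq> 0} \<union> {p. D' p \<noteq> 0} \<subseteq> A"
  shows "Eq G q D' - Eq G q D = (\<Sum>p\<in>A. real_of_int (D p + D' p) * (f p - f q))"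
proof -
  \<comment> \<open>\<open>q\<close> is added because subtracting the degree can put mass there even
    if both divisors vanish at \<open>q\<close>.\<close>
  define B where "B = insert q ({p. D p \<noteq> 0} \<union> {p. D' p \<noteq> 0})"
  have B: "finite B" "q \<in> B" "\<And>p. p \<in> B \<Longrightarrow> valid G p" "\<And>p. p \<notin> B \<Longrightarrow> D p = 0 \<and> D' p = 0"
    using D D' q by (auto simp: B_def is_div_def)
  have suppf: "{p. Delta G f p \<noteq> 0} \<subseteq> B"
    unfolding diff[symmetric] by (auto simp: B_def)
  have deg_B: "deg D = (\<Sum>p\<in>B. D p)" "deg D' = (\<Sum>p\<in>B. D' p)"
    by (rule deg_eq_sum[OF B(1)]; simp add: B_def subset_iff)+
  then have "real_of_int (deg D') - real_of_int (deg D) = (\<Sum>p\<in>B. Delta G f p)"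
    unfolding diff[symmetric] by (simp add: sum_subtractf)
  also have "\<dots> = 0"
    by (rule sum_Delta_eq_0[OF G f B(1) suppf])
  finally have deg: "deg D' = deg D" by simp
  define \<mu> where "\<mu> E p = real_of_int (E p) - (if p = q then real_of_int (deg E) else 0)" for E p
  have Eq: "Eq G q E = energy G (\<mu> E) (\<mu> E)" for E
    unfolding Eq_def \<mu>_def Let_def ..
  have supp: "\<mu> E p = 0" if "E \<in> {D, D'}" "p \<notin> B" for E p
    using that(1) B(2) B(4)[OF that(2)] that(2) by (auto simp: \<mu>_def)
  have sum0: "(\<Sum>p\<in>B. \<mu> E p) = 0" if "E \<in> {D, D'}" for E
  proof -
    have "(\<Sum>p\<in>B. \<mu> E p) = real_of_int (\<Sum>p\<in>B. E p) - real_of_int (deg E)"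
      unfolding \<mu>_def sum_subtractf using B(1,2) by simp
    also have "deg E = (\<Sum>p\<in>B. E p)"
      using that deg_B by blast
    finally show ?thesis by simp
  qed
  have ex: "\<exists>h\<in>PA G. Delta G h = \<mu> E" if "E \<in> {D, D'}" for E
    using exists_Delta_eq[OF G B(1,3) supp[OF that] sum0[OF that]] by blast
  obtain h where h: "h \<in> PA G" "Delta G h = \<mu> D" "Eq G q D = dirichlet_form G h h"
    using energy_eq_dirichlet_form[OF G ex[of D]] unfolding Eq by blast
  obtain h' where h': "h' \<in> PA G" "Delta G h' = \<mu> D'" "Eq G q D' = dirichlet_form G h' h'"
    using energy_eq_dirichlet_form[OF G ex[of D']] unfolding Eq by blast
  have form: "dirichlet_form G k g = (\<Sum>p\<in>B. Delta G k p * g p)" if "k \<in> {f, h, h'}" for k g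
  proof (rule green_identity[OF G _ B(1), symmetric])
    show "k \<in> PA G" using that f h h' by auto
    have "k = f \<or> Delta G k = \<mu> D \<or> Delta G k = \<mu> D'" using that h(2) h'(2) by auto
    moreover have "{p. \<mu> D p \<noteq> 0} \<subseteq> B" "{p. \<mu> D' p \<noteq> 0} \<subseteq> B"
      using supp[of D] supp[of D'] by blast+
    ultimately show "{p. Delta G k p \<noteq> 0} \<subseteq> B"
      using suppf by (elim disjE) simp_all
  qed
  have \<mu>_diff: "Delta G f p = \<mu> D' p - \<mu> D p" for p
    unfolding \<mu>_def deg diff[symmetric] by simp
  have cross: "dirichlet_form G h' h = dirichlet_form G h h'"
    by (rule dirichlet_form_commute[OF G h'(1) h(1)])
  \<comment> \<open>Polarisation: with the equal cross terms inserted, each bracket is a difference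
    in the first argument only, which \<open>\<mu>_diff\<close> identifies with
    \<open>f\<close>.\<close>
  have "Eq G q D' - Eq G q D = (dirichlet_form G h' h' - dirichlet_form G h h') + (dirichlet_form G h' h - dirichlet_form G h h)"
    using cross h(3) h'(3) by linarith
  also have "\<dots> = dirichlet_form G f h' + dirichlet_form G f h"
    by (simp only: form insertI1 insertI2 h(2) h'(2) \<mu>_diff left_diff_distrib sum_subtractf)
  also have "\<dots> = dirichlet_form G h' f + dirichlet_form G h f"
    by (simp only: dirichlet_form_commute[OF G f h(1)] dirichlet_form_commute[OF G f h'(1)])
  also have "\<dots> = (\<Sum>p\<in>B. (\<mu> D p + \<mu> D' p) * f p)"
    by (simp add: form[of h] form[of h'] h(2) h'(2) distrib_right sum.distrib)
  \<comment> \<open>Both normalised divisors have mass zero, so a constant may be subtracted from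
    \<open>f\<close>; the choice \<open>f q\<close> then removes the degree correction at
    \<open>q\<close>.\<close>
  also have "\<dots> = (\<Sum>p\<in>B. (\<mu> D p + \<mu> D' p) * f p) - (\<Sum>p\<in>B. \<mu> D p + \<mu> D' p) * f q"
    using sum0[of D] sum0[of D'] by (simp add: sum.distrib)
  also have "\<dots> = (\<Sum>p\<in>B. (\<mu> D p + \<mu> D' p) * (f p - f q))"
    by (simp only: right_diff_distrib sum_subtractf sum_distrib_right)
  also have "\<dots> = (\<Sum>p\<in>B. real_of_int (D p + D' p) * (f p - f q))"
    by (intro sum.cong) (auto simp: \<mu>_def)
  also have "\<dots> = (\<Sum>p\<in>{p. D p \<noteq> 0} \<union> {p. D' p \<noteq> 0}. real_of_int (D p + D' p) * (f p - f q))"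
    using B(1) by (intro sum.mono_neutral_right) (auto simp: B_def)
  also have "\<dots> = (\<Sum>p\<in>A. real_of_int (D p + D' p) * (f p - f q))"
    using A by (intro sum.mono_neutral_left) auto
  finally show ?thesis .
qed

section \<open>Integrality, truncation and membership in the linear system\<close>

lemma Delta_RG_in_Ints:
  assumes G: "metric_graph G" and f: "f \<in> RG G"
  shows "Delta G f p \<in> \<int>"
proof -
  have aff: "locally_affine \<int> (edgefun G f e) 0 (len G e)" if "e \<in> edges G" for e
    using f that by (simp add: RG_iff[OF G])
  have r: "rslope (edgefun G f e) t \<in> \<int>" if "e \<in> edges G" "0 \<le> t" "t < len G e" for e t
    using aff[OF that(1)] that rslope_eq unfolding locally_affine_def by blast
  have l: "lslope (edgefun G f e) t \<in> \<int>" if "e \<in> edges G" "0 < t" "t \<le> len G e" for e t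
    using aff[OF that(1)] that lslope_eq unfolding locally_affine_def by blast
  show ?thesis
    by (cases p) (auto simp: metric_graphD[OF G] intro!: Ints_diff r l)
qed

text \<open>On \<open>{f < k}\<close> the functions \<open>min f k\<close> and \<open>f\<close> have the same Laplacian, on \<open>{f > k}\<close> the
  Laplacian vanishes, and on the level set all outgoing slopes of \<open>min f k\<close> are nonpositive.\<close>

lemma Delta_min:
  assumes G: "metric_graph G" and f: "f \<in> PA G" and p: "valid G p"
  shows "f p < k \<Longrightarrow> Delta G (\<lambda>p. min (f p) k) p = Delta G f p"
    and "k \<le> f p \<Longrightarrow> 0 \<le> Delta G (\<lambda>p. min (f p) k) p"
proof -
  note [simp] = metric_graphD[OF G]
  let ?m = "\<lambda>p. min (f p) k"
  have aff: "locally_affine UNIV (edgefun G f e) 0 (len G e)" if "e \<in> edges G" for e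
    using f that by (simp add: PA_iff[OF G])
  have r: "rslope (edgefun G ?m e) t =
      (if edgefun G f e t < k then rslope (edgefun G f e) t
       else if k < edgefun G f e t then 0 else min (rslope (edgefun G f e) t) 0)"
    if et: "e \<in> edges G" "0 \<le> t" "t < len G e" for e t
  proof -
    obtain c where c: "affine_right (edgefun G f e) t c"
      using aff[OF et(1)] et unfolding locally_affine_def by blast
    show ?thesis
      using rslope_eq[OF c] rslope_eq[OF affine_right_min[OF c, of k]] by (simp add: edgefun_min)
  qed
  have l: "lslope (edgefun G ?m e) t =
      (if edgefun G f e t < k then lslope (edgefun G f e) t
       else if k < edgefun G f e t then 0 else max (lslope (edgefun G f e) t) 0)"
    if et: "e \<in> edges G" "0 < t" "t \<le> len G e" for e t
  proof -
    obtain c where c: "affine_left (edgefun G f e) t c"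
      using aff[OF et(1)] et unfolding locally_affine_def by blast
    show ?thesis
      using lslope_eq[OF c] lslope_eq[OF affine_left_min[OF c, of k]] by (simp add: edgefun_min)
  qed
  show "Delta G ?m p = Delta G f p" if "f p < k"
  proof (cases p)
    case (Vert v)
    have "(\<Sum>e\<in>{e\<in>edges G. src G e = v}. rslope (edgefun G ?m e) 0)
        = (\<Sum>e\<in>{e\<in>edges G. src G e = v}. rslope (edgefun G f e) 0)"
      using that Vert by (intro sum.cong) (auto simp: r edgefun_0)
    moreover have "(\<Sum>e\<in>{e\<in>edges G. tgt G e = v}. lslope (edgefun G ?m e) (len G e))
        = (\<Sum>e\<in>{e\<in>edges G. tgt G e = v}. lslope (edgefun G f e) (len G e))"
      using that Vert by (intro sum.cong) (auto simp: l edgefun_len)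
    ultimately show ?thesis by (simp add: Vert)
  next
    case (Inner e t)
    with that p show ?thesis by (simp add: r l edgefun_inner)
  qed
  show "0 \<le> Delta G ?m p" if "k \<le> f p"
  proof (cases p)
    case (Vert v)
    have "(\<Sum>e\<in>{e\<in>edges G. src G e = v}. rslope (edgefun G ?m e) 0) \<le> 0"
      using that Vert by (intro sum_nonpos) (auto simp: r edgefun_0)
    moreover have "(\<Sum>e\<in>{e\<in>edges G. tgt G e = v}. lslope (edgefun G ?m e) (len G e)) \<ge> 0"
      using that Vert by (intro sum_nonneg) (auto simp: l edgefun_len)
    ultimately show ?thesis by (simp add: Vert)
  next
    case (Inner e t)
    with that p show ?thesis by (auto simp: r l edgefun_inner)
  qed
qed

text \<open>\<open>lin_equiv\<close> compares valid points only; divisors and Laplacians vanish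
  elsewhere, so the equation extends to all points.\<close>

lemma lin_sysD:
  assumes G: "metric_graph G" and "is_div G D" "D' \<in> lin_sys G q D"
  obtains f where "f \<in> RG G" "\<And>p. real_of_int (D' p - D p) = Delta G f p"
proof -
  obtain f where f: "f \<in> RG G" "\<And>p. valid G p \<Longrightarrow> real_of_int (D' p - D p) = Delta G f p"
    using assms by (auto simp: lin_sys_def lin_equiv_def)
  have "real_of_int (D' p - D p) = Delta G f p" if "\<not> valid G p" for p
    using assms that by (auto simp: lin_sys_def is_div_def Delta_invalid)
  with f that show thesis by blast
qed

text \<open>Integer slopes make the Laplacian integral, so the floor in
  \<open>div_plus_Delta\<close> is exact.\<close>

lemma div_plus_Delta_eq:
  assumes "metric_graph G" "f \<in> RG G"
  shows "real_of_int (div_plus_Delta G D f p) = D p + Delta G f p"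
proof -
  obtain z where "Delta G f p = of_int z"
    using Delta_RG_in_Ints[OF assms] by (rule Ints_cases)
  then show ?thesis by (simp add: div_plus_Delta_def del: Delta.simps)
qed

lemma div_plus_Delta_in_lin_sys:
  assumes G: "metric_graph G" and D: "is_div G D" and f: "f \<in> RG G"
    and nonneg: "\<And>p. valid G p \<Longrightarrow> p \<noteq> q \<Longrightarrow> 0 \<le> D p + Delta G f p"
  shows "div_plus_Delta G D f \<in> lin_sys G q D"
proof -
  let ?E = "div_plus_Delta G D f"
  note E = div_plus_Delta_eq[OF G f, of D]
  have "{p. ?E p \<noteq> 0} \<subseteq> {p. D p \<noteq> 0} \<union> {p. Delta G f p \<noteq> 0}"
    by (auto simp: div_plus_Delta_def)
  then have "finite {p. ?E p \<noteq> 0}"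
    using D finite_Delta_support[OF G, of f] f RG_subset_PA[OF G]
    by (auto simp: is_div_def intro: finite_subset)
  then have "is_div G ?E"
    using D by (auto simp: is_div_def div_plus_Delta_def Delta_invalid)
  moreover have "lin_equiv G ?E D"
    unfolding lin_equiv_def using f E by (intro bexI[of _ f]) auto
  moreover have "0 \<le> ?E p" if "valid G p" "p \<noteq> q" for p
    using nonneg[OF that] E[of p] by linarith
  ultimately show ?thesis by (auto simp: lin_sys_def)
qed

lemma q_reducedD:
  assumes "q_reduced G q D" "f \<in> RG G" "valid G p" "valid G p'" "f p \<noteq> f p'"
    and "\<And>p. valid G p \<Longrightarrow> f p \<le> f q"
  shows "div_plus_Delta G D f \<notin> lin_sys G q D"
  using assms unfolding q_reduced_def by blast

lemma q_reduced_imp_min_at_q: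
  assumes G: "metric_graph G" and q: "valid G q" and D: "is_div G D" and red: "q_reduced G q D"
    and f: "f \<in> RG G" and nonneg: "\<And>p. valid G p \<Longrightarrow> p \<noteq> q \<Longrightarrow> 0 \<le> D p + Delta G f p"
    and p: "valid G p"
  shows "f q \<le> f p"
proof (rule ccontr)
  assume less: "\<not> f q \<le> f p"
  let ?m = "\<lambda>p. min (f p) (f q)"
  note fPA = subsetD[OF RG_subset_PA[OF G] f]
  have m: "?m \<in> RG G" by (rule RG_min[OF G f])
  \<comment> \<open>Below the level \<open>f q\<close> the truncation leaves
    \<open>D + \<Delta>(f)\<close> unchanged; at or above it, (R1) for \<open>D\<close> meets a
    nonnegative Laplacian.\<close>
  have "0 \<le> D p' + Delta G ?m p'" if "valid G p'" "p' \<noteq> q" for p'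
  proof (cases "f p' < f q")
    case True
    then show ?thesis using Delta_min(1)[OF G fPA that(1), of "f q"] nonneg[OF that] by simp
  next
    case False
    moreover have "D p' \<ge> 0" using red that by (simp add: q_reduced_def)
    ultimately show ?thesis using Delta_min(2)[OF G fPA that(1), of "f q"] by simp
  qed
  then have "div_plus_Delta G D ?m \<in> lin_sys G q D"
    by (rule div_plus_Delta_in_lin_sys[OF G D m])
  moreover have "div_plus_Delta G D ?m \<notin> lin_sys G q D"
    using less by (intro q_reducedD[OF red m p q]) auto
  ultimately show False by contradiction
qed

theorem mainTheorem16:
  fixes G :: "('v, 'e) mgraph" and q :: "('v, 'e) pt" and D :: "('v, 'e) pt \<Rightarrow> int"
  assumes "metric_graph G"
    and "valid G q"
    and "is_div G D"
    and "\<forall>p. valid G p \<longrightarrow> p \<noteq> q \<longrightarrow> D p \<ge> 0"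
  shows "q_reduced G q D \<longleftrightarrow> (\<forall>D'\<in>lin_sys G q D. D' \<noteq> D \<longrightarrow> Eq G q D < Eq G q D')"
proof
  note G = assms(1) and q = assms(2) and D = assms(3)
  assume red: "q_reduced G q D"
  show "\<forall>D'\<in>lin_sys G q D. D' \<noteq> D \<longrightarrow> Eq G q D < Eq G q D'"
  proof (intro ballI impI)
    fix D' assume D'D: "D' \<in> lin_sys G q D" "D' \<noteq> D"
    then have D': "is_div G D'" "\<And>p. valid G p \<Longrightarrow> p \<noteq> q \<Longrightarrow> 0 \<le> D' p"
      by (auto simp: lin_sys_def)
    obtain f where f: "f \<in> RG G" and diff: "\<And>p. real_of_int (D' p - D p) = Delta G f p"
      using lin_sysD[OF G D D'D(1)] by blast
    note fPA = subsetD[OF RG_subset_PA[OF G] f]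
    have "0 \<le> D p + Delta G f p" if "valid G p" "p \<noteq> q" for p
      using D'(2)[OF that] diff[of p] by linarith
    then have min: "f q \<le> f p" if "valid G p" for p
      using q_reduced_imp_min_at_q[OF G q D red f _ that] by blast
    define A where "A = {p. D p \<noteq> 0} \<union> {p. D' p \<noteq> 0}"
    have A: "finite A" "\<And>p. p \<in> A \<Longrightarrow> valid G p"
      using D D'(1) by (auto simp: A_def is_div_def)
    have suppf: "{p. Delta G f p \<noteq> 0} \<subseteq> A"
    proof
      fix p assume "p \<in> {p. Delta G f p \<noteq> 0}"
      then show "p \<in> A" using diff[of p] by (auto simp: A_def)
    qed
    have "dirichlet_form G f f \<noteq> 0"
    proof
      assume "dirichlet_form G f f = 0"
      then have const: "f p = f q" if "valid G p" for p
        using dirichlet_form_eq_0_imp_const[OF G fPA _ that q] by blast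
      have "Delta G f p = 0" for p
        using const by (rule Delta_const[OF G])
      then have "D' p = D p" for p using diff[of p] by simp
      with \<open>D' \<noteq> D\<close> show False by blast
    qed
    then have "0 < dirichlet_form G f f"
      using dirichlet_form_nonneg[OF G fPA] by simp
    \<comment> \<open>The Laplacian has mass zero, so \<open>f\<close> may be shifted by
      \<open>f q\<close>.\<close>
    also have "dirichlet_form G f f = (\<Sum>p\<in>A. Delta G f p * f p) - (\<Sum>p\<in>A. Delta G f p) * f q"
      using green_identity[OF G fPA A(1) suppf] sum_Delta_eq_0[OF G fPA A(1) suppf] by simp
    also have "\<dots> = (\<Sum>p\<in>A. Delta G f p * (f p - f q))"
      by (simp add: right_diff_distrib sum_subtractf sum_distrib_right)
    \<comment> \<open>Away from \<open>q\<close>, \<open>D \<ge> 0\<close> gives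
      \<open>D' - D \<le> D + D'\<close>, and the factor \<open>f p - f q\<close> is nonnegative; at
      \<open>q\<close> that factor is zero.\<close>
    also have "\<dots> \<le> (\<Sum>p\<in>A. real_of_int (D p + D' p) * (f p - f q))"
    proof (rule sum_mono)
      fix p assume "p \<in> A"
      then have p: "valid G p" by (rule A(2))
      show "Delta G f p * (f p - f q) \<le> real_of_int (D p + D' p) * (f p - f q)"
      proof (cases "p = q")
        case False
        then have "0 \<le> D p" using assms(4) p by blast
        then show ?thesis
          using min[OF p] by (intro mult_right_mono) (auto simp: diff[symmetric])
      qed simp
    qed
    also have "\<dots> = Eq G q D' - Eq G q D"
      using Eq_diff[OF G q D D'(1) fPA diff A(1)] by (simp add: A_def)
    finally show "Eq G q D < Eq G q D'" by simp
  qed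
next
  note G = assms(1) and q = assms(2) and D = assms(3)
  assume *: "\<forall>D'\<in>lin_sys G q D. D' \<noteq> D \<longrightarrow> Eq G q D < Eq G q D'"
  have "div_plus_Delta G D f \<notin> lin_sys G q D"
    if f: "f \<in> RG G" and nonconst: "\<exists>p p'. valid G p \<and> valid G p' \<and> f p \<noteq> f p'"
      and max: "\<forall>p. valid G p \<longrightarrow> f p \<le> f q" for f
  proof
    let ?D' = "div_plus_Delta G D f"
    assume in_sys: "?D' \<in> lin_sys G q D"
    then have D': "is_div G ?D'" "\<And>p. valid G p \<Longrightarrow> p \<noteq> q \<Longrightarrow> 0 \<le> ?D' p"
      by (auto simp: lin_sys_def)
    note fPA = subsetD[OF RG_subset_PA[OF G] f]
    have diff: "real_of_int (?D' p - D p) = Delta G f p" for p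
      using div_plus_Delta_eq[OF G f] by simp
    \<comment> \<open>Otherwise \<open>f\<close> is harmonic, so its Dirichlet form vanishes and
      \<open>f\<close> is constant. Distinctness is what makes the strict energy inequality
      available.\<close>
    have "?D' \<noteq> D"
    proof
      assume "?D' = D"
      then have "Delta G f p = 0" for p using diff[of p] by simp
      then have "dirichlet_form G f f = 0"
        using green_identity[OF G fPA, of "{}" f] by simp
      with nonconst show False
        using dirichlet_form_eq_0_imp_const[OF G fPA] by blast
    qed
    with * in_sys have "Eq G q D < Eq G q ?D'" by blast
    define A where "A = {p. D p \<noteq> 0} \<union> {p. ?D' p \<noteq> 0}"
    have A: "finite A" "\<And>p. p \<in> A \<Longrightarrow> valid G p"
      using D D'(1) by (auto simp: A_def is_div_def)
    have "Eq G q ?D' - Eq G q D = (\<Sum>p\<in>A. real_of_int (D p + ?D' p) * (f p - f q))"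
      using Eq_diff[OF G q D D'(1) fPA diff A(1)] by (simp add: A_def)
    also have "\<dots> \<le> 0"
    proof (rule sum_nonpos)
      fix p assume "p \<in> A"
      then have p: "valid G p" by (rule A(2))
      show "real_of_int (D p + ?D' p) * (f p - f q) \<le> 0"
      proof (cases "p = q")
        case False
        then have "0 \<le> D p + ?D' p" using assms(4) D'(2) p by simp
        then show ?thesis
          using max p by (intro mult_nonneg_nonpos) (auto simp del: of_int_add)
      qed simp
    qed
    finally show False
      using \<open>Eq G q D < Eq G q ?D'\<close> by simp
  qed
  with assms(4) show "q_reduced G q D"
    unfolding q_reduced_def by blast
qed

end
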